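(* Let $0<\alpha<1$, $A>0$, let $\mathcal{P}_\alpha=\{(x,y)\in\mathbb{R}\times\mathbb{R}: x>0,\ |y|<Ax^\alpha\}$ be the parabola-shaped domain in the plane, and let $z_0=(1,0)$. There are positive constants $C_1$ and $C_2$ depending only on $\alpha$ and $A$ such that, as $t\to\infty$ (that is, for all sufficiently large $t$), $$C_1\exp\Big[-\frac{\pi}{2A(1-\alpha)}\,t^{1-\alpha}\Big]\ \le\ P_{z_0}\{|B_{\tau_\alpha}|>t\}\ \le\ C_2\exp\Big[-\frac{\pi}{2A(1-\alpha)}\,t^{1-\alpha}+\mathrm{o}(t^{1-\alpha})\Big].$$
   Context: $\{B_t:t\ge 0\}$ is two-dimensional Brownian motion; $P_z$ is the probability associated with this motion started at $z$. $\tau_\alpha=\inf\{t>0: B_t\notin\mathcal{P}_\alpha\}$ is the exit time from $\mathcal{P}_\alpha$ and $B_{\tau_\alpha}$ is the exit position. *)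

theory Defs
  imports "HOL-Probability.Probability" "HOL-Library.Landau_Symbols"
begin

text \<open>
  Standard planar Brownian motion started at \<open>z\<close>, indexed by the real times \<open>t \<ge> 0\<close> (the values of
  \<open>B\<close> at negative times are irrelevant).  All paths, not just almost all, are continuous: on an
  incomplete probability space this is what makes events involving exit times measurable.
  Independence of the increments from \<open>B 0\<close> is automatic, as \<open>B 0\<close> is almost surely constant.
\<close>

locale planar_brownian_motion = prob_space M
  for M :: "'w measure" and B :: "real \<Rightarrow> 'w \<Rightarrow> real \<times> real" and z :: "real \<times> real" +
  assumes random_variable_B: "0 \<le> t \<Longrightarrow> random_variable borel (B t)"
    and start: "AE \<omega> in M. B 0 \<omega> = z"
    and continuous_paths: "\<omega> \<in> space M \<Longrightarrow> continuous_on {0..} (\<lambda>t. B t \<omega>)"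
    and gaussian_increments: "0 \<le> s \<Longrightarrow> s < t \<Longrightarrow>
      distributed M lborel (\<lambda>\<omega>. B t \<omega> - B s \<omega>)
        (\<lambda>(x, y). ennreal (normal_density 0 (sqrt (t - s)) x * normal_density 0 (sqrt (t - s)) y))"
    and independent_increments: "0 \<le> T 0 \<Longrightarrow> strict_mono T \<Longrightarrow>
      indep_vars (\<lambda>_. borel) (\<lambda>i \<omega>. B (T (Suc i)) \<omega> - B (T i) \<omega>) {..<n::nat}"

definition exit_time :: "(real \<Rightarrow> 'w \<Rightarrow> 'b) \<Rightarrow> 'b set \<Rightarrow> 'w \<Rightarrow> ereal" where
  "exit_time B D \<omega> = Inf {ereal t | t. 0 < t \<and> B t \<omega> \<notin> D}"

text \<open>Meaningful only where the exit time is finite.\<close>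

definition exit_position :: "(real \<Rightarrow> 'w \<Rightarrow> 'b) \<Rightarrow> 'b set \<Rightarrow> 'w \<Rightarrow> 'b" where
  "exit_position B D \<omega> = B (real_of_ereal (exit_time B D \<omega>)) \<omega>"

definition parabola_domain :: "real \<Rightarrow> real \<Rightarrow> (real \<times> real) set" where
  "parabola_domain A \<alpha> = {(x, y). 0 < x \<and> \<bar>y\<bar> < A * x powr \<alpha>}"

end

theory Submission
  imports Defs "HOL-Complex_Analysis.Complex_Analysis" "HOL-Real_Asymp.Real_Asymp"
begin

text \<open>
  If a bounded function \<open>V\<close> is locally a maximum of real parts of holomorphic functions, then
  \<open>V z \<le> E V(B)\<close> at the exit time.  This follows by stopping Brownian motion along a time grid,
  because the first- and second-order Taylor terms of a holomorphic function integrate to zero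
  against the Gaussian, leaving an error \<open>O(h\<^bsup>3/2\<^esup>)\<close> for each step of length \<open>h\<close>.
  Write \<open>\<beta> = 1 - \<alpha>\<close> and \<open>c = pi / (2 A \<beta>)\<close>.  On the domain \<open>|Im z\<^bsup>\<beta>\<^esup>| < A \<beta>\<close>, so
  \<open>Re exp (c (1 - \<epsilon>) z\<^bsup>\<beta>\<^esup>)\<close> is a positive harmonic function there, which gives the upper bound up
  to \<open>\<epsilon>\<close>.  For the lower bound, the phase \<open>c (z\<^bsup>\<beta>\<^esup> - 3 A\<^sup>2 z\<^bsup>-\<beta>\<^esup>)\<close> has imaginary part at least
  \<open>pi / 2\<close> in absolute value off the domain, at the cost of only a bounded factor.
\<close>

section \<open>Local maxima of harmonic functions\<close>

text \<open>The rate: near abscissa \<open>x\<close> the map \<open>c z^\<beta>\<close> scales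
  heights by about \<open>c \<beta> x^(\<beta>-1)\<close>, and \<open>c\<close> is chosen so that
  the half-width \<open>A x^\<alpha>\<close> becomes \<open>pi/2\<close>, where the cosine factor of
  the exponential vanishes. Since \<open>z^\<beta>\<close> sends the boundary curve slightly inside
  that strip, the real part of the exponential stays positive on the boundary: good for an upper
  bound, useless for a lower one, which needs zero boundary values up to distance \<open>t\<close>.
  All inequalities are one-sided. A maximum is bounded below by whichever harmonic piece is active,
  so pieces can be glued without smoothness. The cubic Taylor error is uniform only on compact sets,
  and a time grid reliably detects exits only from closed sets; hence the passage from grid to
  compact set and from compact sets to the open domain. Test functions must be bounded, so the
  domain is cut at \<open>x = T\<close> for the upper bound, and a barrier ends the support for the
  lower bound. There, paths still inside at time \<open>n\<close> are handled by the smallness of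
  the Gaussian density, without separately proving that the exit time is finite.\<close>

definition to_complex :: "real \<times> real \<Rightarrow> complex" where
  "to_complex w = Complex (fst w) (snd w)"

text \<open>Quantitative subharmonicity. The real part of \<open>b\<close> times a square is a
  trace-free quadratic form, so it has mean zero under an isotropic Gaussian. \<open>v\<close>
  ranges over the whole plane because a Gaussian step can land anywhere; \<open>C\<close> is chosen
  before \<open>w\<close> because the errors are summed along a path.\<close>

definition submean_on :: "(real \<times> real) set \<Rightarrow> (real \<times> real \<Rightarrow> real) \<Rightarrow> bool" where
  "submean_on K V \<longleftrightarrow> (\<exists>C\<ge>0. \<forall>w\<in>K. \<exists>a b. \<forall>v.
     V w + Re (a * to_complex v + b * (to_complex v)\<^sup>2) - C * norm v ^ 3 \<le> V (w + v))"

lemma Re_to_complex [simp]: "Re (to_complex w) = fst w"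
  and Im_to_complex [simp]: "Im (to_complex w) = snd w"
  by (simp_all add: to_complex_def)

lemma to_complex_add: "to_complex (v + w) = to_complex v + to_complex w"
  by (simp add: complex_eq_iff)

lemma norm_to_complex [simp]: "norm (to_complex w) = norm w"
  by (cases w) (simp add: to_complex_def cmod_def norm_Pair)

lemma continuous_on_to_complex [continuous_intros]:
  "continuous_on S f \<Longrightarrow> continuous_on S (\<lambda>x. to_complex (f x))"
  unfolding to_complex_def Complex_eq by (intro continuous_intros)

section \<open>Gaussian moments and the error of one step\<close>

lemma has_bochner_integral_pair_mult:
  fixes f g :: "_ \<Rightarrow> real"
  assumes "sigma_finite_measure M1" "sigma_finite_measure M2"
    and f: "has_bochner_integral M1 f a" and g: "has_bochner_integral M2 g b"
  shows "has_bochner_integral (M1 \<Otimes>\<^sub>M M2) (\<lambda>w. f (fst w) * g (snd w)) (a * b)"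
proof -
  interpret pair_sigma_finite M1 M2
    using assms by (simp add: pair_sigma_finite_def)
  have f': "integrable M1 f" "integral\<^sup>L M1 f = a" and g': "integrable M2 g" "integral\<^sup>L M2 g = b"
    using f g by (auto simp: has_bochner_integral_iff)
  have [measurable]: "f \<in> borel_measurable M1" "g \<in> borel_measurable M2"
    using f' g' by auto
  have int: "integrable (M1 \<Otimes>\<^sub>M M2) (\<lambda>w. f (fst w) * g (snd w))"
  proof (rule Fubini_integrable)
    show "integrable M1 (\<lambda>x. \<integral>y. norm (f (fst (x, y)) * g (snd (x, y))) \<partial>M2)"
      using f' by (simp add: abs_mult)
    show "AE x in M1. integrable M2 (\<lambda>y. f (fst (x, y)) * g (snd (x, y)))"
      using g' by simp
  qed measurable
  moreover have "(\<integral>w. f (fst w) * g (snd w) \<partial>(M1 \<Otimes>\<^sub>M M2)) = a * b"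
    using f' g' by (simp add: integral_fst'[OF int, symmetric])
  ultimately show ?thesis
    by (simp add: has_bochner_integral_iff)
qed

lemma has_bochner_integral_density_normal:
  assumes "has_bochner_integral lborel (\<lambda>x. normal_density 0 \<sigma> x * f x) a"
    and "f \<in> borel_measurable borel"
  shows "has_bochner_integral (density lborel (normal_density 0 \<sigma>)) f a"
  using assms by (intro has_bochner_integral_density) (auto simp: normal_density_nonneg)

lemma add_abs_power3_le: "(\<bar>p\<bar> + \<bar>q\<bar>) ^ 3 \<le> 4 * (\<bar>p\<bar> ^ 3 + \<bar>q\<bar> ^ 3)" for p q :: real
proof -
  have "4 * (\<bar>p\<bar> ^ 3 + \<bar>q\<bar> ^ 3) - (\<bar>p\<bar> + \<bar>q\<bar>) ^ 3 = 3 * (\<bar>p\<bar> + \<bar>q\<bar>) * (\<bar>p\<bar> - \<bar>q\<bar>)\<^sup>2"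
    by (simp add: power2_eq_square power3_eq_cube algebra_simps)
  also have "\<dots> \<ge> 0" by simp
  finally show ?thesis by linarith
qed

text \<open>Odd moments and the mixed moment vanish, and the two squares cancel because both
  coordinates have variance \<open>\<sigma>\<^sup>2\<close>. Only the cubic term survives:
  \<open>4\<close> from splitting the norm into coordinates, two coordinates, and a third absolute
  moment of at most \<open>2 * \<sigma> ^ 3\<close> each give \<open>16\<close>.\<close>

lemma normal_pair_integral_ge:
  fixes g :: "real \<times> real \<Rightarrow> real"
  assumes \<sigma>: "0 < \<sigma>" and C: "0 \<le> C"
    and g[measurable]: "g \<in> borel_measurable borel" and bdd: "\<And>v. \<bar>g v\<bar> \<le> Cb"
    and lower: "\<And>v. Re (a * to_complex v + b * (to_complex v)\<^sup>2) - C * norm v ^ 3 \<le> g v"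
  shows "- 16 * C * \<sigma> ^ 3
    \<le> (\<integral>v. g v \<partial>density lborel (\<lambda>(x, y). ennreal (normal_density 0 \<sigma> x * normal_density 0 \<sigma> y)))"
proof -
  let ?N = "density lborel (normal_density 0 \<sigma>)"
  let ?G = "density lborel (\<lambda>(x, y). ennreal (normal_density 0 \<sigma> x * normal_density 0 \<sigma> y))"
  interpret N: prob_space ?N
    using \<sigma> by (rule prob_space_normal_density)
  have GN: "?G = ?N \<Otimes>\<^sub>M ?N"
    by (subst pair_measure_density)
       (auto simp: lborel_prod ennreal_mult' normal_density_nonneg lborel.sigma_finite_measure_axioms
          N.sigma_finite_measure_axioms)
  interpret NN: pair_prob_space ?N ?N ..
  have sf: "sigma_finite_measure ?N" ..
  note normal = has_bochner_integral_density_normal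
  have m0: "has_bochner_integral ?N (\<lambda>x. 1 :: real) 1"
    using N.prob_space by (simp add: has_bochner_integral_iff)
  have m1: "has_bochner_integral ?N (\<lambda>x. x) 0"
    using normal_moment_odd[OF \<sigma>, of 0 0] by (intro normal) auto
  have m2: "has_bochner_integral ?N (\<lambda>x. x\<^sup>2) (\<sigma>\<^sup>2)"
    using normal_moment_even[OF \<sigma>, of 0 1] by (intro normal) (simp_all add: power2_eq_square)
  have m3: "has_bochner_integral ?N (\<lambda>x. \<bar>x\<bar> ^ 3) (2 * sqrt (2 / pi) * \<sigma> ^ 3)"
    using normal_moment_abs_odd[OF \<sigma>, of 0 1] by (intro normal) (auto simp: mult_ac numeral_3_eq_3)
  note prod = has_bochner_integral_pair_mult[OF sf sf]
  have p10: "has_bochner_integral (?N \<Otimes>\<^sub>M ?N) (\<lambda>v. fst v) 0"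
    using prod[OF m1 m0] by simp
  have p01: "has_bochner_integral (?N \<Otimes>\<^sub>M ?N) (\<lambda>v. snd v) 0"
    using prod[OF m0 m1] by simp
  have p11: "has_bochner_integral (?N \<Otimes>\<^sub>M ?N) (\<lambda>v. fst v * snd v) 0"
    using prod[OF m1 m1] by simp
  have p20: "has_bochner_integral (?N \<Otimes>\<^sub>M ?N) (\<lambda>v. (fst v)\<^sup>2) (\<sigma>\<^sup>2)"
    using prod[OF m2 m0] by simp
  have p02: "has_bochner_integral (?N \<Otimes>\<^sub>M ?N) (\<lambda>v. (snd v)\<^sup>2) (\<sigma>\<^sup>2)"
    using prod[OF m0 m2] by simp
  have p30: "has_bochner_integral (?N \<Otimes>\<^sub>M ?N) (\<lambda>v. \<bar>fst v\<bar> ^ 3) (2 * sqrt (2 / pi) * \<sigma> ^ 3)"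
    using prod[OF m3 m0] by simp
  have p03: "has_bochner_integral (?N \<Otimes>\<^sub>M ?N) (\<lambda>v. \<bar>snd v\<bar> ^ 3) (2 * sqrt (2 / pi) * \<sigma> ^ 3)"
    using prod[OF m0 m3] by simp
  define H where "H v = (Re a * fst v - Im a * snd v + Re b * ((fst v)\<^sup>2 - (snd v)\<^sup>2) - 2 * Im b * (fst v * snd v))
      - C * 4 * (\<bar>fst v\<bar> ^ 3 + \<bar>snd v\<bar> ^ 3)" for v :: "real \<times> real"
  have H: "has_bochner_integral (?N \<Otimes>\<^sub>M ?N) H
      (Re a * 0 - Im a * 0 + Re b * (\<sigma>\<^sup>2 - \<sigma>\<^sup>2) - 2 * Im b * 0
      - C * 4 * (2 * sqrt (2 / pi) * \<sigma> ^ 3 + 2 * sqrt (2 / pi) * \<sigma> ^ 3))"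
    unfolding H_def
    by (intro has_bochner_integral_diff has_bochner_integral_add has_bochner_integral_mult_right p10 p01 p11 p20 p02 p30 p03)
  have "H v \<le> g v" for v
  proof -
    have "norm v \<le> \<bar>fst v\<bar> + \<bar>snd v\<bar>"
      using norm_Pair_le[of "fst v" "snd v"] by simp
    then have "norm v ^ 3 \<le> 4 * (\<bar>fst v\<bar> ^ 3 + \<bar>snd v\<bar> ^ 3)"
      by (rule order_trans[OF power_mono[OF _ norm_ge_zero] add_abs_power3_le])
    then have "C * norm v ^ 3 \<le> C * 4 * (\<bar>fst v\<bar> ^ 3 + \<bar>snd v\<bar> ^ 3)"
      using C by (simp add: mult_left_mono mult.assoc)
    then show ?thesis
      using lower[of v] by (simp add: H_def power2_eq_square algebra_simps)
  qed
  moreover have "integrable (?N \<Otimes>\<^sub>M ?N) g"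
  proof (rule NN.P.integrable_const_bound[where B = Cb])
    show "g \<in> borel_measurable (?N \<Otimes>\<^sub>M ?N)"
      using g by (simp add: GN[symmetric])
  qed (use bdd in auto)
  ultimately have "(\<integral>v. H v \<partial>(?N \<Otimes>\<^sub>M ?N)) \<le> (\<integral>v. g v \<partial>(?N \<Otimes>\<^sub>M ?N))"
    using H by (intro integral_mono) (auto simp: has_bochner_integral_iff)
  moreover have "(\<integral>v. H v \<partial>(?N \<Otimes>\<^sub>M ?N)) = - (16 * (C * (\<sigma> ^ 3 * sqrt (2 / pi))))"
    using H by (simp add: has_bochner_integral_iff mult_ac)
  moreover have "sqrt (2 / pi) \<le> 1"
    using pi_gt3 by simp
  then have "C * (\<sigma> ^ 3 * sqrt (2 / pi)) \<le> C * \<sigma> ^ 3"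
    using \<sigma> C by (simp add: mult_left_le mult_left_mono)
  ultimately show ?thesis
    unfolding GN by linarith
qed

section \<open>Quadratic minorants from Taylor expansion\<close>

text \<open>\<open>V\<close> touches \<open>Re F\<close> from above at the contact points, so there
  the second Taylor polynomial of \<open>F\<close> minorises \<open>V\<close> up to a cubic error.
  Restricting the claim to contact points lets each piece of a maximum be treated
  separately.\<close>

lemma submean_at_holomorphic:
  fixes V :: "real \<times> real \<Rightarrow> real" and F :: "complex \<Rightarrow> complex"
  assumes "open U" and hol: "F holomorphic_on U"
    and K: "compact K" "to_complex ` K \<subseteq> U"
    and bdd: "\<And>w. \<bar>V w\<bar> \<le> Cb"
    and ge: "\<And>w. to_complex w \<in> U \<Longrightarrow> Re (F (to_complex w)) \<le> V w"
  shows "\<exists>C\<ge>0. \<forall>w\<in>K. V w = Re (F (to_complex w)) \<longrightarrow> (\<exists>a b. \<forall>v.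
     V w + Re (a * to_complex v + b * (to_complex v)\<^sup>2) - C * norm v ^ 3 \<le> V (w + v))"
proof -
  have cK: "compact (to_complex ` K)"
    using K by (intro compact_continuous_image continuous_on_to_complex continuous_on_id)
  obtain d where d: "d > 0" "(\<Union>z\<in>to_complex ` K. cball z d) \<subseteq> U"
  proof -
    obtain e where "e > 0" "(\<Union>z\<in>to_complex ` K. ball z e) \<subseteq> U"
      using compact_subset_open_imp_ball_epsilon_subset[OF cK \<open>open U\<close> K(2)] by blast
    then have "(\<Union>z\<in>to_complex ` K. cball z (e/2)) \<subseteq> U"
      by (force simp: subset_iff)
    then show ?thesis using \<open>e > 0\<close> by (intro that[of "e/2"]) auto
  qed
  define K' where "K' = (\<Union>z\<in>to_complex ` K. cball z d)"
  have "compact K'"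
  proof -
    have "K' = (\<lambda>(x, y). x + y) ` (to_complex ` K \<times> cball 0 d)"
    proof (intro equalityI subsetI)
      fix y assume "y \<in> K'"
      then obtain z where "z \<in> to_complex ` K" "y \<in> cball z d" by (auto simp: K'_def)
      then show "y \<in> (\<lambda>(x, y). x + y) ` (to_complex ` K \<times> cball 0 d)"
        by (intro image_eqI[of _ _ "(z, y - z)"]) (auto simp: dist_norm norm_minus_commute)
    qed (force simp: K'_def dist_norm)
    moreover have "continuous_on A (\<lambda>(x, y). x + y :: complex)" for A
      by (auto simp: split_def intro!: continuous_intros)
    ultimately show ?thesis
      using compact_continuous_image[OF _ compact_Times[OF cK compact_cball]] by metis
  qed
  have K'U: "K' \<subseteq> U" using d by (simp add: K'_def)
  define f where "f i = (deriv ^^ i) F" for i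
  have f_hol: "f i holomorphic_on U" for i
    unfolding f_def using hol \<open>open U\<close> by (rule holomorphic_higher_deriv)
  have f_deriv: "(f i has_field_derivative f (Suc i) x) (at x)" if "x \<in> U" for i x
    using holomorphic_derivI[OF f_hol[of i] \<open>open U\<close> that] by (simp add: f_def)
  have "\<exists>B. \<forall>x\<in>K'. norm (f i x) \<le> B" for i
  proof -
    have "compact (f i ` K')"
      using \<open>compact K'\<close> K'U f_hol
      by (intro compact_continuous_image) (meson continuous_on_subset holomorphic_on_imp_continuous_on)
    then show ?thesis
      by (meson bounded_iff compact_imp_bounded imageI)
  qed
  then obtain B where B: "\<And>i x. x \<in> K' \<Longrightarrow> norm (f i x) \<le> B i" by metis
  \<comment> \<open>The first summand covers the Taylor remainder for steps up to \<open>d\<close>.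
    Longer steps leave the region of the expansion, but there \<open>norm v / d\<close> exceeds 1,
    and its powers turn the bound \<open>2 * Cb\<close> on the change of \<open>V\<close> as well as
    the linear and quadratic terms into cubic ones.\<close>
  define C where "C = \<bar>B 3\<bar> + (2 * \<bar>Cb\<bar> / d ^ 3 + \<bar>B 1\<bar> / d\<^sup>2 + \<bar>B 2\<bar> / d)"
  have C: "C \<ge> 0" using \<open>d > 0\<close> by (auto simp: C_def)
  have "V w + Re (f 1 (to_complex w) * to_complex v + f 2 (to_complex w) / 2 * (to_complex v)\<^sup>2) - C * norm v ^ 3
      \<le> V (w + v)"
    if "w \<in> K" "V w = Re (F (to_complex w))" for w v
  proof (cases "norm v \<le> d")
    case True
    let ?z = "to_complex w"
    have sub: "cball ?z d \<subseteq> K'" using that by (auto simp: K'_def)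
    have mem: "?z + to_complex v \<in> cball ?z d"
      using True by (simp add: dist_norm)
    have "norm (f 0 (?z + to_complex v) - (\<Sum>i\<le>2. f i ?z * ((?z + to_complex v) - ?z) ^ i / fact i))
        \<le> B 3 * norm ((?z + to_complex v) - ?z) ^ Suc 2 / fact 2"
    proof (rule field_Taylor)
      show "(f i has_field_derivative f (Suc i) x) (at x within cball ?z d)" if "x \<in> cball ?z d" for i x
        using f_deriv sub K'U that by (meson has_field_derivative_at_within subsetD)
      show "norm (f (Suc 2) x) \<le> B 3" if "x \<in> cball ?z d" for x
        using B[of x 3] sub that by (auto simp: numeral_3_eq_3 numeral_2_eq_2)
    qed (use mem \<open>d > 0\<close> in auto)
    moreover define q where "q = f 1 ?z * to_complex v + f 2 ?z / 2 * (to_complex v)\<^sup>2"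
    ultimately have "norm (F (?z + to_complex v) - (F ?z + q)) \<le> B 3 * norm v ^ 3 / 2"
      by (simp add: f_def numeral_2_eq_2 numeral_3_eq_3 diff_diff_add add.assoc)
    then have "\<bar>Re (F (?z + to_complex v)) - Re (F ?z + q)\<bar> \<le> B 3 * norm v ^ 3 / 2"
      by (metis (no_types, opaque_lifting) abs_Re_le_cmod minus_complex.simps(1) order_trans)
    moreover have "B 3 * norm v ^ 3 / 2 \<le> C * norm v ^ 3"
    proof -
      have "B 3 / 2 \<le> C"
        using \<open>d > 0\<close> by (auto simp: C_def intro!: add_increasing2)
      then show ?thesis using mult_right_mono[of "B 3 / 2" C "norm v ^ 3"] by simp
    qed
    moreover have "Re (F (?z + to_complex v)) \<le> V (w + v)"
      using ge[of "w + v"] subsetD[OF K'U subsetD[OF sub mem]] by (simp add: to_complex_add)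
    moreover have "Re (F ?z + q) = V w + Re q" using that by simp
    ultimately show ?thesis unfolding q_def[symmetric] by linarith
  next
    case False
    let ?n = "norm v"
    have n: "?n / d \<ge> 1" using False \<open>d > 0\<close> by simp
    have zK: "to_complex w \<in> K'" using that \<open>d > 0\<close> by (auto simp: K'_def intro!: bexI[of _ w])
    have "Re (f 1 (to_complex w) * to_complex v + f 2 (to_complex w) / 2 * (to_complex v)\<^sup>2)
        \<le> norm (f 1 (to_complex w) * to_complex v) + norm (f 2 (to_complex w) / 2 * (to_complex v)\<^sup>2)"
      by (rule order_trans[OF complex_Re_le_cmod norm_triangle_ineq])
    also have "\<dots> \<le> \<bar>B 1\<bar> * ?n + \<bar>B 2\<bar> * ?n\<^sup>2"
    proof (rule add_mono)
      show "norm (f 1 (to_complex w) * to_complex v) \<le> \<bar>B 1\<bar> * ?n"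
        using B[OF zK, of 1] by (simp add: norm_mult mult_right_mono)
      have "norm (f 2 (to_complex w)) * ?n\<^sup>2 \<le> (\<bar>B 2\<bar> * 2) * ?n\<^sup>2"
        using B[OF zK, of 2] by (intro mult_right_mono) auto
      then show "norm (f 2 (to_complex w) / 2 * (to_complex v)\<^sup>2) \<le> \<bar>B 2\<bar> * ?n\<^sup>2"
        by (simp add: norm_mult norm_divide norm_power)
    qed
    also have "\<dots> \<le> \<bar>B 1\<bar> * ?n * (?n / d)\<^sup>2 + \<bar>B 2\<bar> * ?n\<^sup>2 * (?n / d)"
      using n mult_left_mono[of 1 "(?n/d)\<^sup>2" "\<bar>B 1\<bar> * ?n"] mult_left_mono[of 1 "?n/d" "\<bar>B 2\<bar> * ?n\<^sup>2"]
      by (intro add_mono) auto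
    also have "\<dots> = (\<bar>B 1\<bar> / d\<^sup>2 + \<bar>B 2\<bar> / d) * ?n ^ 3"
      using \<open>d > 0\<close> by (simp add: power2_eq_square power3_eq_cube field_simps)
    finally have 1: "Re (f 1 (to_complex w) * to_complex v + f 2 (to_complex w) / 2 * (to_complex v)\<^sup>2)
       \<le> (\<bar>B 1\<bar> / d\<^sup>2 + \<bar>B 2\<bar> / d) * ?n ^ 3" .
    have "1 \<le> (?n / d) ^ 3" using n by (rule one_le_power)
    from mult_left_mono[OF this, of "2 * \<bar>Cb\<bar>"]
    have 2: "2 * \<bar>Cb\<bar> \<le> 2 * \<bar>Cb\<bar> / d ^ 3 * ?n ^ 3"
      by (simp add: power_divide)
    have 3: "(2 * \<bar>Cb\<bar> / d ^ 3 + (\<bar>B 1\<bar> / d\<^sup>2 + \<bar>B 2\<bar> / d)) * ?n ^ 3 \<le> C * ?n ^ 3"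
      by (intro mult_right_mono) (auto simp: C_def)
    show ?thesis
      using 1 2 3 bdd[of w] bdd[of "w + v"] by (simp add: distrib_right)
  qed
  with C show ?thesis by blast
qed

section \<open>Exit times and optional stopping\<close>

text \<open>The cap at \<open>n\<close> is applied before the conversion to a real number, because
  \<open>real_of_ereal\<close> would send an infinite exit time to 0.\<close>

definition stopped_time :: "(real \<Rightarrow> 'w \<Rightarrow> 'b) \<Rightarrow> 'b set \<Rightarrow> real \<Rightarrow> 'w \<Rightarrow> real" where
  "stopped_time B S n \<omega> = real_of_ereal (min (exit_time B S \<omega>) (ereal n))"

lemma exit_time_nonneg: "0 \<le> exit_time B S \<omega>"
  unfolding exit_time_def by (rule Inf_greatest) (auto simp: less_imp_le)

lemma exit_time_less_iff: "exit_time B S \<omega> < x \<longleftrightarrow> (\<exists>t>0. ereal t < x \<and> B t \<omega> \<notin> S)"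
  unfolding exit_time_def by (auto simp: Inf_less_iff)

lemma exit_time_ge_iff: "x \<le> exit_time B S \<omega> \<longleftrightarrow> (\<forall>t>0. ereal t < x \<longrightarrow> B t \<omega> \<in> S)"
  using exit_time_less_iff[of B S \<omega> x] by (auto simp: not_less[symmetric])

lemma ereal_stopped_time:
  assumes "0 \<le> n"
  shows "ereal (stopped_time B S n \<omega>) = min (exit_time B S \<omega>) (ereal n)"
proof -
  have "0 \<le> min (exit_time B S \<omega>) (ereal n)" "min (exit_time B S \<omega>) (ereal n) \<le> ereal n"
    using assms exit_time_nonneg by auto
  then show ?thesis
    unfolding stopped_time_def by (cases "exit_time B S \<omega>") (auto simp: min_def)
qed

lemma stopped_time_le_iff:
  "0 \<le> n \<Longrightarrow> x \<le> stopped_time B S n \<omega> \<longleftrightarrow> ereal x \<le> exit_time B S \<omega> \<and> x \<le> n"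
  using ereal_stopped_time[of n B S \<omega>] by (metis ereal_less_eq(3) min.bounded_iff)

lemma stopped_time_bounds:
  assumes "0 \<le> n"
  shows "0 \<le> stopped_time B S n \<omega>" "stopped_time B S n \<omega> \<le> n"
proof -
  have "0 \<le> ereal (stopped_time B S n \<omega>)" "ereal (stopped_time B S n \<omega>) \<le> ereal n"
    unfolding ereal_stopped_time[OF assms] using assms exit_time_nonneg[of B S \<omega>] by auto
  then show "0 \<le> stopped_time B S n \<omega>" "stopped_time B S n \<omega> \<le> n"
    by simp_all
qed

lemma before_stopped_time:
  assumes "0 \<le> n" "0 < s" "s < stopped_time B S n \<omega>"
  shows "B s \<omega> \<in> S"
proof -
  have "ereal (stopped_time B S n \<omega>) \<le> exit_time B S \<omega>"
    using ereal_stopped_time[OF assms(1), of B S \<omega>] by simp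
  then show ?thesis
    using assms(2,3) unfolding exit_time_ge_iff by simp
qed

lemma after_stopped_time:
  assumes "0 \<le> n" "stopped_time B S n \<omega> < n" "0 < e"
  obtains s where "0 < s" "stopped_time B S n \<omega> \<le> s" "s < stopped_time B S n \<omega> + e" "B s \<omega> \<notin> S"
proof -
  let ?T = "stopped_time B S n \<omega>"
  have eq: "exit_time B S \<omega> = ereal ?T"
    using ereal_stopped_time[OF assms(1), of B S \<omega>] assms(2) by (auto simp: min_def split: if_splits)
  then have "exit_time B S \<omega> < ereal (?T + e)" using assms by simp
  then obtain s where s: "0 < s" "s < ?T + e" "B s \<omega> \<notin> S"
    by (auto simp: exit_time_less_iff)
  moreover have "?T \<le> s"
    using before_stopped_time[OF assms(1), of s B S \<omega>] s by force
  ultimately show ?thesis using that by blast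
qed

text \<open>If the position at \<open>r\<close> lay in the open set, so would all positions shortly
  after \<open>r\<close>, and the infimum would be larger. This covers \<open>r = 0\<close>.\<close>

lemma notin_at_exit_time:
  fixes B :: "real \<Rightarrow> 'w \<Rightarrow> 'b :: topological_space"
  assumes "open S" "continuous_on {0..} (\<lambda>t. B t \<omega>)" "exit_time B S \<omega> = ereal r"
  shows "B r \<omega> \<notin> S"
proof
  assume *: "B r \<omega> \<in> S"
  have r: "0 \<le> r" using exit_time_nonneg[of B S \<omega>] assms(3) by simp
  have "((\<lambda>t. B t \<omega>) \<longlongrightarrow> B r \<omega>) (at r within {0..})"
    using assms(2) r by (simp add: continuous_on_def)
  then have "\<forall>\<^sub>F t in at r within {0..}. B t \<omega> \<in> S"
    using assms(1) * by (rule topological_tendstoD)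
  then obtain d where d: "d > 0" "\<And>t. t \<ge> 0 \<Longrightarrow> t \<noteq> r \<Longrightarrow> dist t r < d \<Longrightarrow> B t \<omega> \<in> S"
    unfolding eventually_at by auto
  have "exit_time B S \<omega> < ereal (r + d)" using assms(3) d by simp
  then obtain t where t: "t > 0" "t < r + d" "B t \<omega> \<notin> S" by (auto simp: exit_time_less_iff)
  moreover have "r \<le> t"
    using assms(3) t exit_time_ge_iff[of "ereal r" B S \<omega>] by force
  ultimately show False using d(2)[of t] * by (cases "t = r") (auto simp: dist_real_def)
qed

lemma stopped_time_pos:
  fixes B :: "real \<Rightarrow> 'w \<Rightarrow> 'b :: topological_space"
  assumes "open S" "continuous_on {0..} (\<lambda>t. B t \<omega>)" "B 0 \<omega> \<in> S" "0 < n"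
  shows "0 < stopped_time B S n \<omega>"
proof (rule ccontr)
  assume "\<not> ?thesis"
  then have T: "stopped_time B S n \<omega> = 0" using stopped_time_bounds(1)[of n B S \<omega>] assms by simp
  then have "exit_time B S \<omega> = ereal 0"
    using ereal_stopped_time[of n B S \<omega>] assms by (auto simp: min_def split: if_splits)
  then show False using notin_at_exit_time[of S B \<omega>, OF assms(1,2)] assms(3) by blast
qed

text \<open>The position is a left limit of positions in \<open>S\<close>. Positivity of the stopped
  time matters: the exit time ignores time 0, so nothing ties \<open>B 0\<close> to
  \<open>S\<close>.\<close>

lemma at_stopped_time_in_closure:
  fixes B :: "real \<Rightarrow> 'w \<Rightarrow> 'b :: topological_space"
  assumes "continuous_on {0..} (\<lambda>t. B t \<omega>)" "0 \<le> n" and T: "0 < stopped_time B S n \<omega>"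
  shows "B (stopped_time B S n \<omega>) \<omega> \<in> closure S"
proof (rule Lim_in_closed_set)
  let ?T = "stopped_time B S n \<omega>"
  show "closed (closure S)" by simp
  have "((\<lambda>t. B t \<omega>) \<longlongrightarrow> B ?T \<omega>) (at ?T within {0..})"
    using assms(1) T by (simp add: continuous_on_def)
  then show "((\<lambda>t. B t \<omega>) \<longlongrightarrow> B ?T \<omega>) (at ?T within {0<..<?T})"
    by (rule tendsto_within_subset) auto
  show "\<forall>\<^sub>F t in at ?T within {0<..<?T}. B t \<omega> \<in> closure S"
    unfolding eventually_at_filter
    using before_stopped_time[of n _ B S \<omega>] assms(2) closure_subset by (intro always_eventually) force
  show "at ?T within {0<..<?T} \<noteq> bot"
    using T by (simp add: trivial_limit_within islimpt_greaterThanLessThan2)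
qed

section \<open>Exits observed on a time grid\<close>

text \<open>The disjunct \<open>k = j\<close> caps the search at the end of the grid and guarantees
  that \<open>LEAST\<close> has a witness.\<close>

definition skeleton_index :: "(real \<Rightarrow> 'b) \<Rightarrow> 'b set \<Rightarrow> real \<Rightarrow> nat \<Rightarrow> nat" where
  "skeleton_index f K h j = (LEAST k. k = j \<or> f (real k * h) \<notin> K)"

lemma skeleton_index_le: "skeleton_index f K h j \<le> j"
  unfolding skeleton_index_def by (rule Least_le) simp

lemma skeleton_index_le_exit: "f (real k * h) \<notin> K \<Longrightarrow> skeleton_index f K h j \<le> k"
  unfolding skeleton_index_def by (rule Least_le) simp

lemma skeleton_index_cases: "skeleton_index f K h j = j \<or> f (real (skeleton_index f K h j) * h) \<notin> K"
  unfolding skeleton_index_def by (rule LeastI[of _ j]) simp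

text \<open>This is the stopping-time property: whether the walk continues past step
  \<open>k\<close> depends only on grid positions up to \<open>k\<close>, hence not on the next
  increment.\<close>

lemma less_skeleton_index_iff:
  assumes "k < j"
  shows "k < skeleton_index f K h j \<longleftrightarrow> (\<forall>i\<le>k. f (real i * h) \<in> K)"
proof
  assume "k < skeleton_index f K h j"
  then show "\<forall>i\<le>k. f (real i * h) \<in> K"
    using skeleton_index_le_exit[of f _ h K j] by (meson linorder_not_less order.strict_trans1 order_trans)
next
  assume "\<forall>i\<le>k. f (real i * h) \<in> K"
  then show "k < skeleton_index f K h j"
    using skeleton_index_cases[of f K h j] assms by (metis linorder_not_less)
qed

text \<open>Indicators replace a random upper limit of summation, so that expectations can be taken
  term by term.\<close>

lemma skeleton_telescope:
  fixes V :: "'b \<Rightarrow> real"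
  shows "V (f (real (skeleton_index f K h j) * h)) = V (f 0) +
    (\<Sum>k<j. if \<forall>i\<le>k. f (real i * h) \<in> K then V (f (real (Suc k) * h)) - V (f (real k * h)) else 0)"
proof -
  let ?N = "skeleton_index f K h j"
  have "(\<Sum>k<j. if \<forall>i\<le>k. f (real i * h) \<in> K then V (f (real (Suc k) * h)) - V (f (real k * h)) else 0)
      = (\<Sum>k<j. if k < ?N then V (f (real (Suc k) * h)) - V (f (real k * h)) else 0)"
    by (intro sum.cong refl) (simp add: less_skeleton_index_iff)
  also have "\<dots> = (\<Sum>k<?N. V (f (real (Suc k) * h)) - V (f (real k * h)))"
    by (intro sum.mono_neutral_cong_right) (use skeleton_index_le[of f K h j] in auto)
  also have "\<dots> = V (f (real ?N * h)) - V (f 0)"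
    by (subst sum_lessThan_telescope[of "\<lambda>k. V (f (real k * h))"]) simp
  finally show ?thesis by simp
qed

text \<open>A grid point outside \<open>K\<close> at a positive time is a genuine exit, so the grid
  never stops too early. It does not stop much too late either: the complement of \<open>K\<close>
  is open, so an excursion out of \<open>K\<close> lasts for a while and a fine grid hits it. A path
  that merely touches the boundary of an open set could escape the grid.\<close>

lemma skeleton_time_tendsto:
  fixes B :: "real \<Rightarrow> 'w \<Rightarrow> 'b :: topological_space"
  assumes "closed K" and cont: "continuous_on {0..} (\<lambda>t. B t \<omega>)" and "B 0 \<omega> \<in> K" and n: "0 < n"
  shows "(\<lambda>j. real (skeleton_index (\<lambda>t. B t \<omega>) K (n / Suc j) (Suc j)) * (n / Suc j))
    \<longlonglongrightarrow> stopped_time B K n \<omega>"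
proof (rule LIMSEQ_I)
  fix e :: real assume "0 < e"
  let ?T = "stopped_time B K n \<omega>"
  let ?N = "\<lambda>j. skeleton_index (\<lambda>t. B t \<omega>) K (n / Suc j) (Suc j)"
  have T: "0 \<le> ?T" "?T \<le> n" using stopped_time_bounds[of n B K \<omega>] n by auto
  have lower: "?T \<le> real (?N j) * (n / Suc j)" for j
  proof (rule ccontr)
    assume less: "\<not> ?thesis"
    have "?N j \<noteq> Suc j" using less T by auto
    then have out: "B (real (?N j) * (n / Suc j)) \<omega> \<notin> K"
      using skeleton_index_cases[of "\<lambda>t. B t \<omega>" K "n / Suc j" "Suc j"] by blast
    then have "?N j \<noteq> 0" using assms(3) by (metis mult_zero_left of_nat_0)
    then have "0 < real (?N j) * (n / Suc j)" using n by simp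
    then show False using before_stopped_time[of n _ B K \<omega>] less out n by force
  qed
  have "\<exists>J. \<forall>j\<ge>J. real (?N j) * (n / Suc j) < ?T + e"
  proof (cases "?T = n")
    case True
    have "real (?N j) * (n / Suc j) \<le> n" for j
    proof -
      have "real (?N j) * (n / Suc j) \<le> real (Suc j) * (n / Suc j)"
        using n skeleton_index_le[of "\<lambda>t. B t \<omega>" K "n / Suc j" "Suc j"]
        by (intro mult_right_mono) auto
      then show ?thesis by simp
    qed
    then show ?thesis using True \<open>0 < e\<close> by (metis less_add_same_cancel1 order_le_less_trans)
  next
    case False
    then have "?T < n" using T by simp
    obtain s where s: "0 < s" "?T \<le> s" "s < ?T + min e (n - ?T)" "B s \<omega> \<notin> K"
      using after_stopped_time[of n B K \<omega> "min e (n - ?T)"] \<open>?T < n\<close> \<open>0 < e\<close> n by auto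
    have "((\<lambda>t. B t \<omega>) \<longlongrightarrow> B s \<omega>) (at s within {0..})"
      using cont s by (simp add: continuous_on_def)
    then have "\<forall>\<^sub>F t in at s within {0..}. B t \<omega> \<in> - K"
      using \<open>closed K\<close> s by (intro topological_tendstoD) auto
    then obtain d where d: "d > 0" "\<And>t. t \<ge> 0 \<Longrightarrow> t \<noteq> s \<Longrightarrow> dist t s < d \<Longrightarrow> B t \<omega> \<notin> K"
      unfolding eventually_at by auto
    have d': "B t \<omega> \<notin> K" if "t \<ge> s" "t < s + d" for t
      using d(2)[of t] that s by (cases "t = s") (auto simp: dist_real_def)
    \<comment> \<open>A mesh below \<open>?m\<close> has a point at or after \<open>s\<close> and
      before \<open>s + d\<close> that also precedes \<open>?T + e\<close>.\<close>
    let ?m = "min d (?T + e - s)"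
    have "?m > 0" using d s by auto
    then obtain J where J: "n / ?m < real J" using reals_Archimedean2 by blast
    have "real (?N j) * (n / Suc j) < ?T + e" if "j \<ge> J" for j
    proof -
      let ?h = "n / Suc j"
      have h: "0 < ?h" "?h < ?m"
      proof -
        have "n / ?m < real (Suc j)" using J that by linarith
        then have "n < real (Suc j) * ?m" using \<open>?m > 0\<close> by (simp only: pos_divide_less_eq)
        then show "?h < ?m" by (simp only: pos_divide_less_eq mult.commute of_nat_0_less_iff zero_less_Suc)
      qed (use n in auto)
      define k where "k = nat \<lceil>s / ?h\<rceil>"
      have k: "s / ?h \<le> real k" "real k < s / ?h + 1"
        using s h(1) unfolding k_def by (auto simp: of_nat_ceiling, linarith?)
      have k1: "s \<le> real k * ?h"
        using k(1) by (simp only: pos_divide_le_eq[OF h(1)])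
      have "real k - 1 < s / ?h" using k(2) by linarith
      then have "(real k - 1) * ?h < s" by (simp only: pos_less_divide_eq[OF h(1)])
      then have k2: "real k * ?h < s + ?h" by (simp only: left_diff_distrib mult_1 diff_less_eq)
      note k' = k1 k2
      from k' h have "s \<le> real k * ?h" "real k * ?h < s + d" by linarith+
      then have "B (real k * ?h) \<omega> \<notin> K" by (rule d')
      then have "?N j \<le> k" by (rule skeleton_index_le_exit)
      then have "real (?N j) * ?h \<le> real k * ?h" using h(1) by (intro mult_right_mono) auto
      also have "\<dots> < ?T + e" using k' h by linarith
      finally show ?thesis .
    qed
    then show ?thesis by blast
  qed
  then obtain J where J: "\<And>j. j \<ge> J \<Longrightarrow> real (?N j) * (n / Suc j) < ?T + e" by blast
  have "norm (real (?N j) * (n / Suc j) - ?T) < e" if "j \<ge> J" for j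
    using J[OF that] lower[of j] by (simp only: real_norm_def abs_less_iff) linarith
  then show "\<exists>no. \<forall>j\<ge>no. norm (real (?N j) * (n / real (Suc j)) - ?T) < e" by blast
qed

section \<open>Exhausting a domain from inside\<close>

lemma exit_time_mono: "S \<subseteq> S' \<Longrightarrow> exit_time B S \<omega> \<le> exit_time B S' \<omega>"
  unfolding exit_time_def by (rule Inf_superset_mono) auto

text \<open>Up to any time strictly before the stopped time the path traces a compact subset of
  \<open>D\<close>, which some \<open>C m\<close> and all later ones contain. Time 0 belongs to this
  trace, so the start must lie in \<open>D\<close>.\<close>

lemma stopped_time_exhaustion:
  fixes B :: "real \<Rightarrow> 'w \<Rightarrow> 'b :: topological_space"
  assumes cont: "continuous_on {0..} (\<lambda>t. B t \<omega>)" and "B 0 \<omega> \<in> D" and n: "0 < n"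
    and sub: "\<And>m. C m \<subseteq> D"
    and exhaust: "\<And>K. compact K \<Longrightarrow> K \<subseteq> D \<Longrightarrow> \<exists>N::nat. \<forall>m\<ge>N. K \<subseteq> C m"
  shows "(\<lambda>m. stopped_time B (C m) n \<omega>) \<longlonglongrightarrow> stopped_time B D n \<omega>"
proof (rule LIMSEQ_I)
  fix e :: real assume "0 < e"
  let ?T = "stopped_time B D n \<omega>"
  have T: "0 \<le> ?T" "?T \<le> n" using stopped_time_bounds[of n B D \<omega>] n by auto
  have upper: "stopped_time B (C m) n \<omega> \<le> ?T" for m
  proof -
    have "ereal (stopped_time B (C m) n \<omega>) \<le> ereal ?T"
      using exit_time_mono[OF sub[of m], of B \<omega>] n
      by (simp only: ereal_stopped_time less_imp_le) (rule min.mono, auto)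
    then show ?thesis by simp
  qed
  have "\<exists>J. \<forall>m\<ge>J. ?T - e < stopped_time B (C m) n \<omega>"
  proof (cases "?T - e/2 > 0")
    case False
    then have "?T - e < stopped_time B (C m) n \<omega>" for m
      using stopped_time_bounds(1)[of n B "C m" \<omega>] n \<open>0 < e\<close> by simp
    then show ?thesis by blast
  next
    case True
    let ?s = "?T - e/2"
    have "compact ((\<lambda>t. B t \<omega>) ` {0..?s})"
      using cont by (intro compact_continuous_image) (auto intro: continuous_on_subset)
    moreover have "(\<lambda>t. B t \<omega>) ` {0..?s} \<subseteq> D"
    proof safe
      fix t assume "t \<in> {0..?s}"
      then show "B t \<omega> \<in> D"
        using before_stopped_time[of n t B D \<omega>] assms(2) n \<open>0 < e\<close> by (cases "t = 0") auto
    qed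
    ultimately obtain J where J: "\<And>m. m \<ge> J \<Longrightarrow> (\<lambda>t. B t \<omega>) ` {0..?s} \<subseteq> C m"
      using exhaust by blast
    have "?s \<le> stopped_time B (C m) n \<omega>" if "m \<ge> J" for m
    proof -
      have "ereal ?s \<le> exit_time B (C m) \<omega>"
        unfolding exit_time_ge_iff using J[OF that] by (auto simp: image_subset_iff)
      then show ?thesis unfolding stopped_time_le_iff[OF less_imp_le[OF n]] using T \<open>0 < e\<close> by simp
    qed
    then show ?thesis using \<open>0 < e\<close> by (intro exI[of _ J]) fastforce
  qed
  then obtain J where J: "\<And>m. m \<ge> J \<Longrightarrow> ?T - e < stopped_time B (C m) n \<omega>" by blast
  have "norm (stopped_time B (C m) n \<omega> - ?T) < e" if "m \<ge> J" for m
    using J[OF that] upper[of m] \<open>0 < e\<close> by (simp add: abs_less_iff)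
  then show "\<exists>no. \<forall>m\<ge>no. norm (stopped_time B (C m) n \<omega> - ?T) < e" by blast
qed

context planar_brownian_motion begin

section \<open>Expected change along the grid\<close>

text \<open>The condition and the current position are functions of the first \<open>k\<close>
  increments. By independence and Fubini the next increment can be integrated first, with the past
  frozen at a point of \<open>K\<close>, where the Gaussian estimate applies.\<close>

lemma one_step_expectation:
  assumes K[measurable]: "K \<in> sets borel" and V[measurable]: "V \<in> borel_measurable borel"
    and bdd: "\<And>w. \<bar>V w\<bar> \<le> Cb" and C: "0 \<le> C" and h: "0 < h"
    and sub: "\<And>w. w \<in> K \<Longrightarrow> \<exists>a b. \<forall>v.
      V w + Re (a * to_complex v + b * (to_complex v)\<^sup>2) - C * norm v ^ 3 \<le> V (w + v)"
  shows "- 16 * C * sqrt h ^ 3 \<le> expectation (\<lambda>\<omega>. if \<forall>i\<le>k. B (real i * h) \<omega> \<in> K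
      then V (B (real (Suc k) * h) \<omega>) - V (B (real k * h) \<omega>) else 0)"
proof -
  define X where "X i \<omega> = B (real (Suc i) * h) \<omega> - B (real i * h) \<omega>" for i \<omega>
  have B[measurable]: "B (real i * h) \<in> borel_measurable M" for i
    using h by (intro random_variable_B) auto
  have X[measurable]: "X i \<in> borel_measurable M" for i
    unfolding X_def by measurable
  \<comment> \<open>Independence of blocks is stated on product spaces, so the one new increment
    first appears as a function on \<open>{k}\<close> and is read off by evaluation at
    \<open>k\<close>.\<close>
  let ?PP = "PiM {..<k} (\<lambda>_. borel :: (real \<times> real) measure)"
  let ?P = "\<lambda>\<omega>. restrict (\<lambda>i. X i \<omega>) {..<k}"
  let ?PK = "PiM {k} (\<lambda>_. borel :: (real \<times> real) measure)"
  let ?R = "\<lambda>\<omega>. restrict (\<lambda>i. X i \<omega>) {k}"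
  have "indep_vars (\<lambda>_. borel) X {..<Suc k}"
    unfolding X_def[abs_def] using h by (intro independent_increments) (auto simp: strict_mono_def)
  then have "indep_var ?PP ?P ?PK ?R"
    by (rule indep_var_restrict) auto
  then have joint: "distr M ?PP ?P \<Otimes>\<^sub>M distr M ?PK ?R = distr M (?PP \<Otimes>\<^sub>M ?PK) (\<lambda>\<omega>. (?P \<omega>, ?R \<omega>))"
    and P[measurable]: "?P \<in> measurable M ?PP" and R[measurable]: "?R \<in> measurable M ?PK"
    unfolding indep_var_distribution_eq by auto
  have ev[measurable]: "(\<lambda>f. f k) \<in> measurable ?PK borel"
    by (rule measurable_component_singleton) simp
  interpret D: prob_space "distr M ?PP ?P" by (rule prob_space_distr) measurable
  interpret E: prob_space "distr M ?PK ?R" by (rule prob_space_distr) measurable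
  interpret DE: pair_prob_space "distr M ?PP ?P" "distr M ?PK ?R" ..
  \<comment> \<open>Grid positions rebuilt from increments. They start at \<open>z\<close>, whereas
    the motion does so only almost surely, hence the almost-everywhere congruence below.\<close>
  define S where "S p i = z + (\<Sum>l<i. p l)" for p :: "nat \<Rightarrow> real \<times> real" and i
  have S[measurable]: "(\<lambda>p. S p i) \<in> borel_measurable ?PP" if "i \<le> k" for i
    unfolding S_def using that by (intro borel_measurable_add borel_measurable_sum measurable_component_singleton) auto
  define G where "G = (\<lambda>(p, x). if \<forall>i\<le>k. S p i \<in> K then V (S p k + x) - V (S p k) else 0)"
  have G[measurable]: "G \<in> borel_measurable (?PP \<Otimes>\<^sub>M borel)"
    unfolding G_def by measurable
  have Gb: "\<bar>G u\<bar> \<le> 2 * Cb" for u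
  proof -
    obtain p x where u: "u = (p, x)" by (cases u)
    show ?thesis
      using bdd[of "S p k + x"] bdd[of "S p k"] unfolding G_def u by (auto simp: abs_le_iff)
  qed
  have "expectation (\<lambda>\<omega>. if \<forall>i\<le>k. B (real i * h) \<omega> \<in> K
      then V (B (real (Suc k) * h) \<omega>) - V (B (real k * h) \<omega>) else 0) = expectation (\<lambda>\<omega>. G (?P \<omega>, X k \<omega>))"
  proof (rule integral_cong_AE)
    show "AE \<omega> in M. (if \<forall>i\<le>k. B (real i * h) \<omega> \<in> K
      then V (B (real (Suc k) * h) \<omega>) - V (B (real k * h) \<omega>) else 0) = G (?P \<omega>, X k \<omega>)"
      using start
    proof eventually_elim
      fix \<omega> assume "B 0 \<omega> = z"
      have S_eq: "S (?P \<omega>) i = B (real i * h) \<omega>" if "i \<le> k" for i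
      proof -
        have "(\<Sum>l<i. ?P \<omega> l) = (\<Sum>l<i. B (real (Suc l) * h) \<omega> - B (real l * h) \<omega>)"
          using that by (intro sum.cong) (auto simp: X_def)
        also have "\<dots> = B (real i * h) \<omega> - B 0 \<omega>"
          by (subst sum_lessThan_telescope[of "\<lambda>l. B (real l * h) \<omega>"]) simp
        finally show ?thesis by (simp add: S_def \<open>B 0 \<omega> = z\<close>)
      qed
      then show "(if \<forall>i\<le>k. B (real i * h) \<omega> \<in> K
        then V (B (real (Suc k) * h) \<omega>) - V (B (real k * h) \<omega>) else 0) = G (?P \<omega>, X k \<omega>)"
      proof -
        have all_eq: "(\<forall>i\<le>k. S (?P \<omega>) i \<in> K) = (\<forall>i\<le>k. B (real i * h) \<omega> \<in> K)"
          using S_eq by auto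
        have step: "B (real k * h) \<omega> + X k \<omega> = B (real (Suc k) * h) \<omega>"
          by (simp add: X_def)
        show ?thesis
          by (simp only: G_def prod.case S_eq[OF order_refl] all_eq step)
      qed
    qed
  qed measurable
  also have "\<dots> = (\<integral>u. G (fst u, snd u k) \<partial>(distr M ?PP ?P \<Otimes>\<^sub>M distr M ?PK ?R))"
    unfolding joint by (subst integral_distr) auto
  also have "\<dots> = (\<integral>p. (\<integral>f. G (fst (p, f), snd (p, f) k) \<partial>distr M ?PK ?R) \<partial>distr M ?PP ?P)"
    by (rule DE.integral_fst'[symmetric], rule DE.P.integrable_const_bound[where B = "2 * Cb"]) (use Gb in auto)
  also have "\<dots> = (\<integral>p. (\<integral>x. G (p, x) \<partial>distr M borel (X k)) \<partial>distr M ?PP ?P)"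
  proof (rule Bochner_Integration.integral_cong[OF refl])
    fix p assume "p \<in> space (distr M ?PP ?P)"
    then have [measurable]: "(\<lambda>x. G (p, x)) \<in> borel_measurable borel"
      by (intro measurable_Pair2[OF G]) simp
    show "(\<integral>f. G (fst (p, f), snd (p, f) k) \<partial>distr M ?PK ?R) = (\<integral>x. G (p, x) \<partial>distr M borel (X k))"
      by (simp add: integral_distr)
  qed
  also have "\<dots> \<ge> - 16 * C * sqrt h ^ 3"
  proof (rule D.integral_ge_const)
    have X_distr: "distr M borel (X k)
        = density lborel (\<lambda>(x, y). ennreal (normal_density 0 (sqrt h) x * normal_density 0 (sqrt h) y))"
    proof -
      have "distributed M lborel (X k)
        (\<lambda>(x, y). ennreal (normal_density 0 (sqrt h) x * normal_density 0 (sqrt h) y))"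
        using gaussian_increments[of "real k * h" "real (Suc k) * h"] h
        by (simp add: X_def[abs_def] algebra_simps)
      then have "distr M lborel (X k)
        = density lborel (\<lambda>(x, y). ennreal (normal_density 0 (sqrt h) x * normal_density 0 (sqrt h) y))"
        by (rule distributed_distr_eq_density)
      moreover have "distr M lborel (X k) = distr M borel (X k)"
        by (rule distr_cong) auto
      ultimately show ?thesis by simp
    qed
    show "AE p in distr M ?PP ?P. - 16 * C * sqrt h ^ 3 \<le> (\<integral>x. G (p, x) \<partial>distr M borel (X k))"
    proof (rule AE_I2)
      fix p
      show "- 16 * C * sqrt h ^ 3 \<le> (\<integral>x. G (p, x) \<partial>distr M borel (X k))"
      proof (cases "\<forall>i\<le>k. S p i \<in> K")
        case False
        then have "(\<lambda>x. G (p, x)) = (\<lambda>x. 0)" unfolding G_def by (intro ext) auto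
        then show ?thesis using C h by simp
      next
        case True
        then obtain a b where ab: "\<And>v. V (S p k) + Re (a * to_complex v + b * (to_complex v)\<^sup>2) - C * norm v ^ 3 \<le> V (S p k + v)"
          using sub[of "S p k"] by blast
        have "(\<lambda>x. G (p, x)) = (\<lambda>x. V (S p k + x) - V (S p k))" using True by (auto simp: G_def)
        moreover have "- 16 * C * sqrt h ^ 3 \<le> (\<integral>x. V (S p k + x) - V (S p k) \<partial>distr M borel (X k))"
          unfolding X_distr
        proof (rule normal_pair_integral_ge[where Cb = "2 * Cb" and a = a and b = b])
          show "\<bar>V (S p k + v) - V (S p k)\<bar> \<le> 2 * Cb" for v
            using bdd[of "S p k + v"] bdd[of "S p k"] by linarith
          show "Re (a * to_complex v + b * (to_complex v)\<^sup>2) - C * norm v ^ 3 \<le> V (S p k + v) - V (S p k)" for v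
            using ab[of v] by linarith
        qed (use C h in auto)
        ultimately show ?thesis by simp
      qed
    qed
    interpret E': prob_space "distr M borel (X k)" by (rule prob_space_distr) measurable
    interpret DE': pair_prob_space "distr M ?PP ?P" "distr M borel (X k)" ..
    show "integrable (distr M ?PP ?P) (\<lambda>p. \<integral>x. G (p, x) \<partial>distr M borel (X k))"
      by (rule DE'.integrable_fst', rule DE'.P.integrable_const_bound[where B = "2 * Cb"]) (use Gb in auto)
  qed
  finally show ?thesis .
qed

lemma skeleton_expectation:
  fixes j :: nat
  assumes K[measurable]: "K \<in> sets borel" and V[measurable]: "V \<in> borel_measurable borel"
    and bdd: "\<And>w. \<bar>V w\<bar> \<le> Cb" and C: "0 \<le> C" and h: "0 < h"
    and sub: "\<And>w. w \<in> K \<Longrightarrow> \<exists>a b. \<forall>v.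
      V w + Re (a * to_complex v + b * (to_complex v)\<^sup>2) - C * norm v ^ 3 \<le> V (w + v)"
  defines "Y \<equiv> \<lambda>\<omega>. V (B (real (skeleton_index (\<lambda>t. B t \<omega>) K h j) * h) \<omega>)"
  shows "V z - real j * (16 * C * sqrt h ^ 3) \<le> expectation Y"
    and "Y \<in> borel_measurable M"
proof -
  define Q where "Q k \<omega> = (if \<forall>i\<le>k. B (real i * h) \<omega> \<in> K
      then V (B (real (Suc k) * h) \<omega>) - V (B (real k * h) \<omega>) else 0)" for k \<omega>
  have Y: "Y = (\<lambda>\<omega>. V (B 0 \<omega>) + (\<Sum>k<j. Q k \<omega>))"
  proof
    fix \<omega>
    show "Y \<omega> = V (B 0 \<omega>) + (\<Sum>k<j. Q k \<omega>)"
      unfolding Y_def Q_def by (rule skeleton_telescope[where f = "\<lambda>t. B t \<omega>"])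
  qed
  have B[measurable]: "B (real i * h) \<in> borel_measurable M" for i
    using h by (intro random_variable_B) auto
  have Q[measurable]: "Q k \<in> borel_measurable M" for k
    unfolding Q_def by measurable
  have B0[measurable]: "B 0 \<in> borel_measurable M" by (simp add: random_variable_B)
  show "Y \<in> borel_measurable M" unfolding Y by measurable
  have "\<bar>Q k \<omega>\<bar> \<le> 2 * Cb" for k \<omega>
    using bdd[of "B (real (Suc k) * h) \<omega>"] bdd[of "B (real k * h) \<omega>"] by (auto simp: Q_def)
  then have Qint: "integrable M (Q k)" for k
    by (intro integrable_const_bound[where B = "2 * Cb"]) auto
  have V0: "integrable M (\<lambda>\<omega>. V (B 0 \<omega>))"
    using bdd by (intro integrable_const_bound[where B = Cb]) auto
  have "expectation (\<lambda>\<omega>. V (B 0 \<omega>)) = expectation (\<lambda>\<omega>. V z)"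
    using start by (intro integral_cong_AE) (auto elim: eventually_mono)
  then have "expectation Y = V z + (\<Sum>k<j. expectation (Q k))"
    unfolding Y using V0 Qint by (simp add: prob_space)
  moreover have "(\<Sum>k<j. expectation (Q k)) \<ge> (\<Sum>k<j. - 16 * C * sqrt h ^ 3)"
    unfolding Q_def by (intro sum_mono one_step_expectation[OF K V bdd C h sub])
  ultimately show "V z - real j * (16 * C * sqrt h ^ 3) \<le> expectation Y" by simp
qed

section \<open>Measurability of exit times and positions\<close>

text \<open>The complement is open, so by continuity an exit before \<open>y\<close> is already
  witnessed at a rational time shortly afterwards, still before \<open>y\<close>.\<close>

lemma measurable_exit_time_closed:
  assumes "closed K"
  shows "exit_time B K \<in> borel_measurable M"
proof (rule borel_measurableI_less)
  fix y :: ereal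
  have "{\<omega> \<in> space M. exit_time B K \<omega> < y} = (\<Union>q\<in>{q\<in>\<rat>. 0 < q \<and> ereal q < y}. {\<omega> \<in> space M. B q \<omega> \<notin> K})"
  proof (intro equalityI subsetI)
    fix \<omega> assume "\<omega> \<in> {\<omega> \<in> space M. exit_time B K \<omega> < y}"
    then obtain t where t: "\<omega> \<in> space M" "0 < t" "ereal t < y" "B t \<omega> \<notin> K"
      by (auto simp: exit_time_less_iff)
    obtain t' where "ereal t < ereal t'" "ereal t' < y" using ereal_dense2[OF t(3)] by blast
    then have t': "t < t'" "ereal t' < y" by simp_all
    have "((\<lambda>s. B s \<omega>) \<longlongrightarrow> B t \<omega>) (at t within {0..})"
      using continuous_paths[OF t(1)] t by (simp add: continuous_on_def)
    then have "\<forall>\<^sub>F s in at t within {0..}. B s \<omega> \<in> - K"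
      using \<open>closed K\<close> t by (intro topological_tendstoD) auto
    then obtain d where d: "d > 0" "\<And>s. s \<ge> 0 \<Longrightarrow> s \<noteq> t \<Longrightarrow> dist s t < d \<Longrightarrow> B s \<omega> \<notin> K"
      unfolding eventually_at by auto
    obtain q where q: "q \<in> \<rat>" "t < q" "q < min t' (t + d)"
      using Rats_dense_in_real[of t "min t' (t + d)"] t' d by auto
    then have "B q \<omega> \<notin> K" using d(2)[of q] t by (auto simp: dist_real_def)
    moreover have "ereal q < y" using q t' by (meson ereal_less(1) less_ereal.simps(1) min_less_iff_conj order.strict_trans)
    ultimately show "\<omega> \<in> (\<Union>q\<in>{q\<in>\<rat>. 0 < q \<and> ereal q < y}. {\<omega> \<in> space M. B q \<omega> \<notin> K})"
      using q t by auto
  qed (auto simp: exit_time_less_iff)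
  also have "\<dots> \<in> sets M"
  proof (rule sets.countable_UN'')
    show "countable {q\<in>\<rat>. 0 < q \<and> ereal q < y}"
      by (rule countable_subset[OF _ countable_rat]) auto
    show "{\<omega> \<in> space M. B q \<omega> \<notin> K} \<in> sets M" if "q \<in> {q\<in>\<rat>. 0 < q \<and> ereal q < y}" for q
    proof -
      have [measurable]: "B q \<in> borel_measurable M" "K \<in> sets borel"
        using that assms by (auto intro: random_variable_B)
      show ?thesis by measurable
    qed
  qed
  finally show "{\<omega> \<in> space M. exit_time B K \<omega> < y} \<in> sets M" .
qed

text \<open>A path that stays in the open set \<open>D\<close> throughout \<open>[p, q]\<close> keeps a positive distance
  from its complement there.\<close>

lemma measurable_exit_time_open:
  assumes "open D"
  shows "exit_time B D \<in> borel_measurable M"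
\<comment> \<open>With an empty complement \<open>infdist\<close> is 0 by convention, and the sets
  \<open>F p q\<close> would report exits that never happen.\<close>
proof (cases "D = UNIV")
  case True
  then have "exit_time B D = (\<lambda>\<omega>. \<infinity>)" by (auto simp: exit_time_def top_ereal_def)
  then show ?thesis by simp
next
  case False
  \<comment> \<open>For an open set an exit may be a single touch that rational times miss. Coming
    arbitrarily close to the complement at rational times of a compact interval is the countable
    substitute; the minimum of the distance then yields an actual touch.\<close>
  define F where "F p q = (\<Inter>m. \<Union>r\<in>{r\<in>\<rat>. p \<le> r \<and> r \<le> q}. {\<omega> \<in> space M. infdist (B r \<omega>) (- D) < 1 / Suc m})"
    for p q :: real
  have F_sets: "F p q \<in> sets M" if "0 < p" for p q
  proof -
    have "{\<omega> \<in> space M. infdist (B r \<omega>) (- D) < 1 / Suc m} \<in> sets M" if "r \<in> {r\<in>\<rat>. p \<le> r \<and> r \<le> q}" for r m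
    proof -
      have [measurable]: "B r \<in> borel_measurable M"
        using that \<open>0 < p\<close> by (auto intro: random_variable_B)
      have [measurable]: "(\<lambda>x. infdist x (- D)) \<in> borel_measurable borel"
        by (intro borel_measurable_continuous_onI continuous_intros)
      show ?thesis by measurable
    qed
    moreover have "countable {r\<in>\<rat>. p \<le> r \<and> r \<le> q}"
      by (rule countable_subset[OF _ countable_rat]) auto
    ultimately have "(\<Union>r\<in>{r\<in>\<rat>. p \<le> r \<and> r \<le> q}. {\<omega> \<in> space M. infdist (B r \<omega>) (- D) < 1 / Suc m}) \<in> sets M" for m
      by (intro sets.countable_UN'')
    then show ?thesis
      unfolding F_def by (rule sets.countable_INT'[where X = UNIV, OF countableI_type UNIV_not_empty image_subsetI])
  qed
  have F_iff: "\<omega> \<in> F p q \<longleftrightarrow> (\<exists>t\<in>{p..q}. B t \<omega> \<notin> D)"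
    if "\<omega> \<in> space M" "0 < p" "p < q" "p \<in> \<rat>" "q \<in> \<rat>" for \<omega> p q
  proof -
    have cont: "continuous_on {p..q} (\<lambda>t. infdist (B t \<omega>) (- D))"
      using continuous_paths[OF that(1)] that by (intro continuous_intros) (auto intro: continuous_on_subset)
    show ?thesis
    proof
      assume \<omega>: "\<omega> \<in> F p q"
      have "\<exists>t\<in>{p..q}. \<forall>s\<in>{p..q}. infdist (B t \<omega>) (- D) \<le> infdist (B s \<omega>) (- D)"
        using that by (intro continuous_attains_inf cont) auto
      then obtain t where t: "t \<in> {p..q}" "\<And>s. s \<in> {p..q} \<Longrightarrow> infdist (B t \<omega>) (- D) \<le> infdist (B s \<omega>) (- D)"
        by blast
      have "infdist (B t \<omega>) (- D) \<le> 1 / Suc m" for m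
      proof -
        obtain r where "p \<le> r" "r \<le> q" "infdist (B r \<omega>) (- D) < 1 / Suc m"
          using \<omega> by (auto simp: F_def)
        then show ?thesis using t(2)[of r] by auto
      qed
      then have "infdist (B t \<omega>) (- D) \<le> 0"
        by (intro LIMSEQ_le_const[OF lim_1_over_n[THEN LIMSEQ_Suc]]) auto
      then have "infdist (B t \<omega>) (- D) = 0" using infdist_nonneg[of "B t \<omega>" "- D"] by linarith
      then have "B t \<omega> \<in> - D"
        using assms False by (subst in_closed_iff_infdist_zero) auto
      then show "\<exists>t\<in>{p..q}. B t \<omega> \<notin> D" using t by blast
    next
      assume "\<exists>t\<in>{p..q}. B t \<omega> \<notin> D"
      then obtain t where t: "p \<le> t" "t \<le> q" "B t \<omega> \<notin> D" by auto
      have "\<exists>r\<in>\<rat>. p \<le> r \<and> r \<le> q \<and> infdist (B r \<omega>) (- D) < 1 / Suc m" for m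
      proof -
        have "infdist (B t \<omega>) (- D) = 0" using t by (intro infdist_zero) auto
        moreover have "((\<lambda>t. infdist (B t \<omega>) (- D)) \<longlongrightarrow> infdist (B t \<omega>) (- D)) (at t within {p..q})"
          using cont t unfolding continuous_on_def by (blast intro: atLeastAtMost_iff[THEN iffD2])
        ultimately have "\<forall>\<^sub>F s in at t within {p..q}. infdist (B s \<omega>) (- D) < 1 / Suc m"
          by (intro order_tendstoD(2)) auto
        then obtain d where d: "d > 0" "\<And>s. s \<in> {p..q} \<Longrightarrow> s \<noteq> t \<Longrightarrow> dist s t < d \<Longrightarrow> infdist (B s \<omega>) (- D) < 1 / Suc m"
          unfolding eventually_at by auto
        have d': "infdist (B s \<omega>) (- D) < 1 / Suc m" if "s \<in> {p..q}" "\<bar>s - t\<bar> < d" for s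
          using d(2)[of s] that \<open>infdist (B t \<omega>) (- D) = 0\<close> by (cases "s = t") (auto simp: dist_real_def)
        show ?thesis
        \<comment> \<open>At the right end there is no room for a rational beyond \<open>t\<close>,
          but \<open>q\<close> itself is rational.\<close>
        proof (cases "t = q")
          case True
          then show ?thesis using d'[of q] d(1) that by (intro bexI[of _ q]) auto
        next
          case False
          then obtain r where "r \<in> \<rat>" "t < r" "r < min q (t + d)"
            using Rats_dense_in_real[of t "min q (t + d)"] t d by auto
          then show ?thesis using d'[of r] t by (intro bexI[of _ r]) auto
        qed
      qed
      then show "\<omega> \<in> F p q" using that by (fastforce simp: F_def)
    qed
  qed
  show ?thesis
  proof (rule borel_measurableI_less)
    fix y :: ereal
    let ?I = "{(p, q). p \<in> \<rat> \<and> q \<in> \<rat> \<and> 0 < p \<and> p < q \<and> ereal q < y}"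
    have "{\<omega> \<in> space M. exit_time B D \<omega> < y} = (\<Union>(p, q)\<in>?I. F p q)"
    proof (intro equalityI subsetI)
      fix \<omega> assume "\<omega> \<in> {\<omega> \<in> space M. exit_time B D \<omega> < y}"
      then obtain t where t: "\<omega> \<in> space M" "0 < t" "ereal t < y" "B t \<omega> \<notin> D"
        by (auto simp: exit_time_less_iff)
      obtain t' where "ereal t < ereal t'" "ereal t' < y" using ereal_dense2[OF t(3)] by blast
    then have t': "t < t'" "ereal t' < y" by simp_all
      obtain q where q: "q \<in> \<rat>" "t < q" "q < t'" using Rats_dense_in_real[OF t'(1)] by auto
      obtain p where p: "p \<in> \<rat>" "0 < p" "p < t" using Rats_dense_in_real[OF t(2)] by auto
      have "ereal q < y" using q t' by (meson less_ereal.simps(1) order.strict_trans)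
      then have "(p, q) \<in> ?I" using p q by auto
      moreover have "\<omega> \<in> F p q" using F_iff[of \<omega> p q] p q t by force
      ultimately show "\<omega> \<in> (\<Union>(p, q)\<in>?I. F p q)" by blast
    next
      fix \<omega> assume "\<omega> \<in> (\<Union>(p, q)\<in>?I. F p q)"
      then obtain p q where pq: "p \<in> \<rat>" "q \<in> \<rat>" "0 < p" "p < q" "ereal q < y" "\<omega> \<in> F p q" by auto
      then have "\<omega> \<in> space M" by (auto simp: F_def)
      then obtain t where t: "p \<le> t" "t \<le> q" "B t \<omega> \<notin> D" using F_iff[of \<omega> p q] pq by auto
      have "ereal t < y" using t pq by (meson ereal_less_eq(3) order.strict_trans1)
      then show "\<omega> \<in> {\<omega> \<in> space M. exit_time B D \<omega> < y}"
        using \<open>\<omega> \<in> space M\<close> t pq(3) by (auto simp: exit_time_less_iff intro!: exI[of _ t])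
    qed
    also have "\<dots> \<in> sets M"
    proof (rule sets.countable_UN'')
      show "countable ?I"
        by (rule countable_subset[of _ "\<rat> \<times> \<rat>"]) (auto intro: countable_rat)
    qed (auto intro: F_sets)
    finally show "{\<omega> \<in> space M. exit_time B D \<omega> < y} \<in> sets M" .
  qed
qed

text \<open>Rounding the time up to a multiple of \<open>1 / Suc j\<close> leaves countably many
  values, for which measurability is immediate; continuity of the paths gives the limit.\<close>

lemma measurable_value_at_random_time:
  assumes T[measurable]: "T \<in> borel_measurable M" and "\<And>\<omega>. 0 \<le> T \<omega>"
  shows "(\<lambda>\<omega>. B (T \<omega>) \<omega>) \<in> borel_measurable M"
proof (rule borel_measurable_LIMSEQ_metric)
  let ?T = "\<lambda>j \<omega>. real (nat \<lceil>T \<omega> * Suc j\<rceil>) / Suc j"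
  show "(\<lambda>\<omega>. B (?T j \<omega>) \<omega>) \<in> borel_measurable M" for j
  proof (rule measurable_compose_countable[where f = "\<lambda>k \<omega>. B (real k / Suc j) \<omega>"])
    show "B (real k / Suc j) \<in> borel_measurable M" for k by (simp add: random_variable_B)
  qed measurable
  show "(\<lambda>j. B (?T j \<omega>) \<omega>) \<longlonglongrightarrow> B (T \<omega>) \<omega>" if "\<omega> \<in> space M" for \<omega>
  proof -
    have "(\<lambda>j. ?T j \<omega>) \<longlonglongrightarrow> T \<omega>"
    proof (rule tendsto_sandwich)
      have nn: "0 \<le> T \<omega> * Suc j" for j using assms(2)[of \<omega>] by simp
      show "\<forall>\<^sub>F j in sequentially. T \<omega> \<le> ?T j \<omega>"
      proof (rule always_eventually, rule allI)
        fix j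
        have "T \<omega> * Suc j \<le> real (nat \<lceil>T \<omega> * Suc j\<rceil>)" by (rule real_nat_ceiling_ge)
        then show "T \<omega> \<le> ?T j \<omega>" by (simp only: pos_le_divide_eq of_nat_0_less_iff zero_less_Suc)
      qed
      show "\<forall>\<^sub>F j in sequentially. ?T j \<omega> \<le> T \<omega> + 1 / Suc j"
      proof (rule always_eventually, rule allI)
        fix j
        have "real (nat \<lceil>T \<omega> * Suc j\<rceil>) \<le> T \<omega> * Suc j + 1"
          using nn[of j] by (simp del: of_nat_Suc)
        also have "\<dots> = (T \<omega> + 1 / Suc j) * Suc j" by (simp add: distrib_right del: of_nat_Suc)
        finally show "?T j \<omega> \<le> T \<omega> + 1 / Suc j"
          by (simp only: pos_divide_le_eq of_nat_0_less_iff zero_less_Suc)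
      qed
      show "(\<lambda>j. T \<omega> + 1 / Suc j) \<longlonglongrightarrow> T \<omega>"
        using tendsto_add[OF tendsto_const lim_1_over_n[THEN LIMSEQ_Suc], of "T \<omega>"] by simp
    qed simp
    with continuous_paths[OF that] show ?thesis
    proof (rule continuous_on_tendsto_compose)
      show "T \<omega> \<in> {0..}" using assms(2) by simp
      show "\<forall>\<^sub>F j in sequentially. ?T j \<omega> \<in> {0..}"
        by (intro always_eventually allI) (simp only: atLeast_iff divide_nonneg_nonneg of_nat_0_le_iff)
    qed
  qed
qed

lemma measurable_stopped_time:
  assumes [measurable]: "exit_time B S \<in> borel_measurable M"
  shows "stopped_time B S n \<in> borel_measurable M"
  unfolding stopped_time_def by measurable

section \<open>Passage to the limit in the stopping inequality\<close>

text \<open>There are \<open>n / h\<close> steps of length \<open>h\<close>, each losing a multiple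
  of \<open>h^(3/2)\<close>, so the total loss is a multiple of \<open>n * sqrt h\<close>.
  Continuity of \<open>V\<close> is asked on an open set around \<open>K\<close> because the
  position at an observed exit overshoots \<open>K\<close>.\<close>

lemma optional_stopping_closed:
  assumes D: "open D" "K \<subseteq> D" "closed K" "z \<in> K" and n: "0 < n"
    and V[measurable]: "V \<in> borel_measurable borel" and bdd: "\<And>w. \<bar>V w\<bar> \<le> Cb"
    and cont: "continuous_on D V" and sub: "submean_on K V"
  shows "V z \<le> expectation (\<lambda>\<omega>. V (B (stopped_time B K n \<omega>) \<omega>))"
proof -
  obtain C where C: "C \<ge> 0" and sub': "\<And>w. w \<in> K \<Longrightarrow> \<exists>a b. \<forall>v.
     V w + Re (a * to_complex v + b * (to_complex v)\<^sup>2) - C * norm v ^ 3 \<le> V (w + v)"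
    using sub unfolding submean_on_def by blast
  have K: "K \<in> sets borel" using D by auto
  define Y where "Y j \<omega> = V (B (real (skeleton_index (\<lambda>t. B t \<omega>) K (n / Suc j) (Suc j)) * (n / Suc j)) \<omega>)" for j \<omega>
  have h: "0 < n / Suc j" for j using n by simp
  note Yj = skeleton_expectation[OF K V bdd C h sub']
  have Y: "V z - real (Suc j) * (16 * C * sqrt (n / Suc j) ^ 3) \<le> expectation (Y j)" for j
    unfolding Y_def by (rule Yj(1))
  have [measurable]: "Y j \<in> borel_measurable M" for j
    unfolding Y_def by (rule Yj(2))
  have [measurable]: "(\<lambda>\<omega>. B (stopped_time B K n \<omega>) \<omega>) \<in> borel_measurable M"
    using n D
    by (intro measurable_value_at_random_time measurable_stopped_time measurable_exit_time_closed
        stopped_time_bounds(1)) auto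
  have lim1: "(\<lambda>j. expectation (Y j)) \<longlonglongrightarrow> expectation (\<lambda>\<omega>. V (B (stopped_time B K n \<omega>) \<omega>))"
  proof (rule integral_dominated_convergence[where w = "\<lambda>_. Cb"])
    show "AE \<omega> in M. (\<lambda>j. Y j \<omega>) \<longlonglongrightarrow> V (B (stopped_time B K n \<omega>) \<omega>)"
      using start AE_space
    proof eventually_elim
      fix \<omega> assume \<omega>: "B 0 \<omega> = z" "\<omega> \<in> space M"
      note path = continuous_paths[OF \<omega>(2)]
      have lim: "(\<lambda>j. B (real (skeleton_index (\<lambda>t. B t \<omega>) K (n / Suc j) (Suc j)) * (n / Suc j)) \<omega>)
        \<longlonglongrightarrow> B (stopped_time B K n \<omega>) \<omega>"
        using path stopped_time_bounds(1)[of n B K \<omega>] n D \<omega>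
        by (intro continuous_on_tendsto_compose[where f = "\<lambda>t. B t \<omega>" and s = "{0..}"]
            skeleton_time_tendsto always_eventually) auto
      have "B (stopped_time B K n \<omega>) \<omega> \<in> D"
      proof (cases "stopped_time B K n \<omega> = 0")
        case False
        let ?T = "stopped_time B K n \<omega>"
        have T: "0 < ?T" using False stopped_time_bounds(1)[of n B K \<omega>] n by simp
        then have "B ?T \<omega> \<in> closure K"
          using path n by (intro at_stopped_time_in_closure) auto
        then have "B ?T \<omega> \<in> K" using \<open>closed K\<close> by simp
        then show ?thesis using D by blast
      qed (use D \<omega> in auto)
      then have "isCont V (B (stopped_time B K n \<omega>) \<omega>)"
        using cont D(1) continuous_on_eq_continuous_at by blast
      then show "(\<lambda>j. Y j \<omega>) \<longlonglongrightarrow> V (B (stopped_time B K n \<omega>) \<omega>)"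
        unfolding Y_def using lim by (rule isCont_tendsto_compose)
    qed
  qed (use bdd in \<open>auto simp: Y_def\<close>)
  have lim2: "(\<lambda>j. V z - real (Suc j) * (16 * C * sqrt (n / Suc j) ^ 3)) \<longlonglongrightarrow> V z"
  proof -
    have eq: "real (Suc j) * (16 * C * sqrt (n / Suc j) ^ 3) = 16 * C * (n * sqrt (n / Suc j))" for j
      using n by (simp add: power3_eq_cube real_sqrt_mult_self field_simps del: of_nat_Suc)
    have "(\<lambda>j. V z - 16 * C * (n * sqrt (n / Suc j))) \<longlonglongrightarrow> V z - 16 * C * (n * sqrt 0)"
      using tendsto_mult[OF tendsto_const lim_1_over_n[THEN LIMSEQ_Suc], of n]
      by (intro tendsto_intros) (simp del: of_nat_Suc)
    then show ?thesis
      by (simp only: eq real_sqrt_zero mult_zero_right diff_zero)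
  qed
  show ?thesis
    by (rule LIMSEQ_le[OF lim2 lim1]) (use Y in blast)
qed

lemma measurable_stopped_value:
  assumes "open D" "0 \<le> n"
  shows "(\<lambda>\<omega>. B (stopped_time B D n \<omega>) \<omega>) \<in> borel_measurable M"
  using assms by (intro measurable_value_at_random_time measurable_stopped_time
    measurable_exit_time_open stopped_time_bounds(1))

lemma measurable_exit_position:
  assumes "open D"
  shows "exit_position B D \<in> borel_measurable M"
  unfolding exit_position_def[abs_def]
proof (rule measurable_value_at_random_time)
  have [measurable]: "exit_time B D \<in> borel_measurable M"
    using assms by (rule measurable_exit_time_open)
  show "(\<lambda>\<omega>. real_of_ereal (exit_time B D \<omega>)) \<in> borel_measurable M"
    by measurable
qed (intro real_of_ereal_pos exit_time_nonneg)

text \<open>The constant in \<open>submean_on\<close> may blow up towards the boundary, so stopping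
  is done on an exhaustion by compact sets. All positions met in this limit lie in the closure of
  \<open>D\<close>, which is why \<open>V\<close> may be discontinuous elsewhere.\<close>

theorem optional_stopping:
  assumes D: "open D" "z \<in> D" and n: "0 < n"
    and V[measurable]: "V \<in> borel_measurable borel" and bdd: "\<And>w. \<bar>V w\<bar> \<le> Cb"
    and cont: "continuous_on (closure D) V"
    and sub: "\<And>K. compact K \<Longrightarrow> K \<subseteq> D \<Longrightarrow> submean_on K V"
  shows "V z \<le> expectation (\<lambda>\<omega>. V (B (stopped_time B D n \<omega>) \<omega>))"
proof -
  have "\<exists>C. (\<forall>m. compact (C m)) \<and> (\<forall>m. C m \<subseteq> D) \<and>
      (\<forall>K. compact K \<longrightarrow> K \<subseteq> D \<longrightarrow> (\<exists>N::nat. \<forall>m\<ge>N. K \<subseteq> C m))"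
  proof (rule open_Union_compact_subsets[OF D(1)])
    fix C assume "\<And>n. compact (C n)" "\<And>n. C n \<subseteq> D"
      "\<And>K. \<lbrakk>compact K; K \<subseteq> D\<rbrakk> \<Longrightarrow> \<exists>N::nat. \<forall>n\<ge>N. K \<subseteq> C n"
    then show ?thesis by (intro exI[of _ C]) simp
  qed
  then obtain C where C: "\<And>m. compact (C m)" "\<And>m. C m \<subseteq> D"
      "\<And>K. \<lbrakk>compact K; K \<subseteq> D\<rbrakk> \<Longrightarrow> \<exists>N::nat. \<forall>m\<ge>N. K \<subseteq> C m"
    by blast
  obtain N where N: "\<And>m. m \<ge> N \<Longrightarrow> z \<in> C m" using C(3)[of "{z}"] D by auto
  have cD: "continuous_on D V" using cont closure_subset by (rule continuous_on_subset)
  have meas[measurable]: "(\<lambda>\<omega>. B (stopped_time B S n \<omega>) \<omega>) \<in> borel_measurable M"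
    if "closed S \<or> open S" for S
    using n that
    by (intro measurable_value_at_random_time measurable_stopped_time stopped_time_bounds(1))
       (auto intro: measurable_exit_time_closed measurable_exit_time_open)
  have [measurable]: "(\<lambda>\<omega>. B (stopped_time B D n \<omega>) \<omega>) \<in> borel_measurable M"
     "(\<lambda>\<omega>. B (stopped_time B (C m) n \<omega>) \<omega>) \<in> borel_measurable M" for m
    using meas D C(1)[THEN compact_imp_closed] by auto
  have "(\<lambda>m. expectation (\<lambda>\<omega>. V (B (stopped_time B (C m) n \<omega>) \<omega>)))
    \<longlonglongrightarrow> expectation (\<lambda>\<omega>. V (B (stopped_time B D n \<omega>) \<omega>))"
  proof (rule integral_dominated_convergence[where w = "\<lambda>_. Cb"])
    show "AE \<omega> in M. (\<lambda>m. V (B (stopped_time B (C m) n \<omega>) \<omega>)) \<longlonglongrightarrow> V (B (stopped_time B D n \<omega>) \<omega>)"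
      using start AE_space
    proof eventually_elim
      fix \<omega> assume \<omega>: "B 0 \<omega> = z" "\<omega> \<in> space M"
      note path = continuous_paths[OF \<omega>(2)]
      have "(\<lambda>m. B (stopped_time B (C m) n \<omega>) \<omega>) \<longlonglongrightarrow> B (stopped_time B D n \<omega>) \<omega>"
        using path stopped_time_bounds(1)[of n B _ \<omega>] n D \<omega> C
        by (intro continuous_on_tendsto_compose[where f = "\<lambda>t. B t \<omega>" and s = "{0..}"]
            stopped_time_exhaustion always_eventually) auto
      moreover have "B (stopped_time B D n \<omega>) \<omega> \<in> closure D"
        using path D n \<omega> by (intro at_stopped_time_in_closure stopped_time_pos) auto
      moreover have "\<forall>\<^sub>F m in sequentially. B (stopped_time B (C m) n \<omega>) \<omega> \<in> closure D"
        unfolding eventually_sequentially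
      proof (intro exI[of _ N] allI impI)
        fix m assume "N \<le> m"
        let ?T = "stopped_time B (C m) n \<omega>"
        show "B ?T \<omega> \<in> closure D"
        proof (cases "?T = 0")
          case True
          then show ?thesis using \<omega> D closure_subset by auto
        next
          case False
          have T: "0 < ?T" using False stopped_time_bounds(1)[of n B "C m" \<omega>] n by simp
          have "B ?T \<omega> \<in> closure (C m)"
            using path n T by (intro at_stopped_time_in_closure) auto
          then show ?thesis using closure_mono[OF C(2)[of m]] by blast
        qed
      qed
      ultimately show "(\<lambda>m. V (B (stopped_time B (C m) n \<omega>) \<omega>)) \<longlonglongrightarrow> V (B (stopped_time B D n \<omega>) \<omega>)"
        using cont by (intro continuous_on_tendsto_compose[where f = V and s = "closure D"])
    qed
  qed (use bdd in auto)
  then show ?thesis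
  proof (rule LIMSEQ_le_const)
    show "\<exists>N. \<forall>m\<ge>N. V z \<le> expectation (\<lambda>\<omega>. V (B (stopped_time B (C m) n \<omega>) \<omega>))"
      using N C D cD n bdd sub by (intro exI[of _ N] allI impI optional_stopping_closed) (auto intro: compact_imp_closed)
  qed
qed

end

section \<open>The upper bound\<close>

text \<open>The clamp at 0 makes the height a continuous function on the whole plane, so strict and
  weak inequalities define open and closed sets.\<close>

lemma parabola_domain_alt:
  assumes "0 < \<alpha>"
  shows "parabola_domain A \<alpha> = {w. 0 < fst w} \<inter> {w. \<bar>snd w\<bar> < A * max 0 (fst w) powr \<alpha>}"
  by (auto simp: parabola_domain_def)

lemma open_parabola_domain:
  assumes "0 < \<alpha>"
  shows "open (parabola_domain A \<alpha>)"
  unfolding parabola_domain_alt[OF assms] using assms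
  by (intro open_Int open_Collect_less continuous_intros continuous_on_powr') auto

lemma closure_parabola_domain_subset:
  assumes "0 < \<alpha>"
  shows "closure (parabola_domain A \<alpha>) \<subseteq> {w. 0 \<le> fst w \<and> \<bar>snd w\<bar> \<le> A * fst w powr \<alpha>}"
proof -
  have "closure (parabola_domain A \<alpha>) \<subseteq> {w. 0 \<le> fst w} \<inter> {w. \<bar>snd w\<bar> \<le> A * max 0 (fst w) powr \<alpha>}"
    unfolding parabola_domain_alt[OF assms] using assms
    by (intro closure_minimal closed_Int closed_Collect_le continuous_intros continuous_on_powr') auto
  then have "w \<in> {w. 0 \<le> fst w} \<inter> {w. \<bar>snd w\<bar> \<le> A * max 0 (fst w) powr \<alpha>}"
    if "w \<in> closure (parabola_domain A \<alpha>)" for w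
    using that by blast
  then show ?thesis by (force simp: max_def)
qed

lemma norm_le_fst_add_snd: "norm w \<le> \<bar>fst w\<bar> + \<bar>snd w\<bar>" for w :: "real \<times> real"
  using norm_Pair_le[of "fst w" "snd w"] by simp

lemma powr_of_real_polar:
  "z \<noteq> 0 \<Longrightarrow> z powr of_real b = of_real (norm z powr b) * exp (\<i> * of_real (b * Arg z))"
  by (simp add: powr_def Ln_Arg exp_add distrib_left exp_of_real mult_ac flip: of_real_mult)

lemma norm_powr_of_real: "norm (z powr of_real b) = norm z powr b" for z :: complex
  by (cases "z = 0") (auto simp: powr_def norm_exp_eq_Re)

lemma Re_powr_of_real: "z \<noteq> 0 \<Longrightarrow> Re (z powr of_real b) = norm z powr b * cos (b * Arg z)"
  by (simp add: powr_of_real_polar Re_exp)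

lemma abs_Arg_less: "0 < Re z \<Longrightarrow> \<bar>Arg z\<bar> < pi / 2"
  using Re_Ln_pos_lt[of z] by (cases "z = 0") (auto simp: Arg_eq_Im_Ln)

lemma Re_powr_of_real_nonneg:
  assumes "0 < Re z" "0 \<le> b" "b \<le> 1"
  shows "0 \<le> Re (z powr of_real b)"
proof -
  have "\<bar>Arg z\<bar> < pi / 2" using assms(1) by (rule abs_Arg_less)
  then have "\<bar>b * Arg z\<bar> \<le> pi / 2"
    using assms mult_mono[of b 1 "\<bar>Arg z\<bar>" "pi/2"] by (simp add: abs_mult)
  then have "0 \<le> cos (b * Arg z)" by (intro cos_ge_zero) auto
  then show ?thesis using assms by (subst Re_powr_of_real) auto
qed

text \<open>The power is real at the real point \<open>Re z\<close>, and its derivative on the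
  half-plane to the right of that point is largest at abscissa \<open>Re z\<close> since
  \<open>b < 1\<close>; the mean value estimate finishes. With \<open>b = 1 - \<alpha>\<close> the
  factor cancels the growth of the parabola exactly and leaves \<open>b * A\<close>.\<close>

lemma abs_Im_powr_of_real_le:
  assumes "0 < Re z" "0 < b" "b < 1"
  shows "\<bar>Im (z powr of_real b)\<bar> \<le> b * Re z powr (b - 1) * \<bar>Im z\<bar>"
proof -
  let ?S = "{w. Re z \<le> Re w}" and ?x = "complex_of_real (Re z)"
  have nz: "w \<notin> \<real>\<^sub>\<le>\<^sub>0" if "w \<in> ?S" for w
    using that assms by (auto simp: complex_nonpos_Reals_iff)
  have "norm (z powr of_real b - ?x powr of_real b) \<le> (b * Re z powr (b - 1)) * norm (z - ?x)"
  proof (rule field_differentiable_bound)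
    show "convex ?S" by (rule convex_halfspace_Re_ge)
    fix w assume w: "w \<in> ?S"
    show "((\<lambda>w. w powr of_real b) has_field_derivative of_real b * w powr (of_real b - 1)) (at w within ?S)"
      by (rule has_field_derivative_at_within[OF has_field_derivative_powr[OF nz[OF w]]])
    have "Re z \<le> norm w" using w complex_Re_le_cmod[of w] by auto
    then have "norm w powr (b - 1) \<le> Re z powr (b - 1)"
      using assms by (intro powr_mono2') auto
    moreover have "norm (w powr (of_real b - 1)) = norm w powr (b - 1)"
      using norm_powr_of_real[of w "b - 1"] by simp
    ultimately show "norm (of_real b * w powr (of_real b - 1)) \<le> b * Re z powr (b - 1)"
      using assms by (simp add: norm_mult mult_left_mono)
  qed auto
  moreover have "Im (?x powr of_real b) = 0"
    using assms by (simp add: powr_of_real)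
  moreover have "norm (z - ?x) = \<bar>Im z\<bar>"
    by (simp add: cmod_def)
  ultimately show ?thesis
    using abs_Im_le_cmod[of "z powr of_real b - ?x powr of_real b"] by simp
qed

text \<open>The exponent \<open>c (1 - \<epsilon>)\<close> with \<open>\<epsilon> > 0\<close> keeps the harmonic function
  \<open>Re exp (c (1 - \<epsilon>) (z + 1)\<^bsup>1 - \<alpha>\<^esup>)\<close> positive up to the boundary of the domain; the shift by 1
  moves its singularity away from the closure.\<close>

lemma exit_tail_upper_explicit:
  fixes \<alpha> A \<epsilon> T t :: real
  assumes \<alpha>: "0 < \<alpha>" "\<alpha> < 1" and A: "0 < A" and \<epsilon>: "0 < \<epsilon>" "\<epsilon> < 1"
    and T: "1 < T" "T + A * T powr \<alpha> \<le> t"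
    and BM: "planar_brownian_motion M B (1, 0)"
  defines "D \<equiv> parabola_domain A \<alpha>" and "\<kappa> \<equiv> pi / (2 * A * (1 - \<alpha>)) * (1 - \<epsilon>)"
  shows "measure M {\<omega> \<in> space M. exit_time B D \<omega> < \<infinity> \<and> norm (exit_position B D \<omega>) > t}
    \<le> exp (\<kappa> * (2 powr (1 - \<alpha>) + (1 - \<alpha>) * A)) / cos ((1 - \<epsilon>) * (pi / 2)) * exp (- \<kappa> * T powr (1 - \<alpha>))"
proof -
  interpret planar_brownian_motion M B "(1, 0)" by (rule BM)
  define \<beta> where "\<beta> = 1 - \<alpha>"
  have \<beta>: "0 < \<beta>" "\<beta> < 1" using \<alpha> by (auto simp: \<beta>_def)
  \<comment> \<open>The domain goes into a strip of half-width
    \<open>(1 - \<epsilon>) * (pi / 2)\<close>, short of \<open>pi / 2\<close>, so the cosine is at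
    least \<open>\<gamma>\<close>, which is positive.\<close>
  have \<kappa>: "0 < \<kappa>" "\<kappa> * (\<beta> * A) = (1 - \<epsilon>) * (pi / 2)"
    using \<alpha> A \<epsilon> by (auto simp: \<kappa>_def \<beta>_def)
  define \<gamma> where "\<gamma> = cos ((1 - \<epsilon>) * (pi / 2))"
  have \<gamma>: "0 < \<gamma>"
    unfolding \<gamma>_def using \<epsilon> pi_gt_zero mult_strict_right_mono[of "1 - \<epsilon>" 1 "pi / 2"] 
    by (intro cos_gt_zero_pi) (auto intro: less_le_trans[of _ 0])
  define F where "F z = exp (of_real \<kappa> * (z + 1) powr of_real \<beta>)" for z :: complex
  \<comment> \<open>Points of the closure of \<open>DT\<close> have norm at most
    \<open>T + A * T powr \<alpha>\<close>, so the ball contains them. Cutting off outside it makes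
    \<open>V\<close> globally bounded; the jump stays away from the closure of
    \<open>DT\<close>.\<close>
  define R where "R = T + A * T powr \<alpha> + 2"
  have R: "2 < R" using T A by (auto simp: R_def intro: add_pos_nonneg)
  define U where "U = {z. - 1 < Re z} \<inter> ball 0 R"
  \<comment> \<open>The minus sign reverses the inequality of \<open>optional_stopping\<close>: the
    expected value of \<open>Re F\<close> at the stopped position is at most its initial
    value.\<close>
  define V where "V w = (if to_complex w \<in> U then - Re (F (to_complex w)) else 0)" for w
  \<comment> \<open>A path leaving \<open>D\<close> far out must first cross the line
    \<open>x = T\<close>. Stopping on that line gives a bounded region and a value of
    \<open>Re F\<close> known from below.\<close>
  define DT where "DT = D \<inter> {w. fst w < T}"
  have open_D: "open D" unfolding D_def using \<alpha> by (intro open_parabola_domain) auto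
  have open_DT: "open DT"
    unfolding DT_def using open_D by (intro open_Int open_Collect_less continuous_intros) auto
  have "closure DT \<subseteq> closure D \<inter> {w. fst w \<le> T}"
    unfolding DT_def by (intro closure_minimal closed_Int closed_Collect_le continuous_intros)
      (use closure_subset in auto)
  then have cl: "0 \<le> fst w" "\<bar>snd w\<bar> \<le> A * fst w powr \<alpha>" "fst w \<le> T" "w \<in> closure D" if "w \<in> closure DT" for w
    using closure_parabola_domain_subset[OF \<alpha>(1), of A] that unfolding D_def by auto
  have clU: "to_complex w \<in> U" if "w \<in> closure DT" for w
  proof -
    have "A * fst w powr \<alpha> \<le> A * T powr \<alpha>"
      using cl[OF that] A \<alpha> by (intro mult_left_mono powr_mono2) auto
    then have "norm w < R"
      using norm_le_fst_add_snd[of w] cl[OF that] by (simp add: R_def)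
    then show ?thesis using cl[OF that] by (simp add: U_def)
  qed
  have Im_bound: "\<bar>\<kappa> * Im ((to_complex w + 1) powr of_real \<beta>)\<bar> \<le> (1 - \<epsilon>) * (pi / 2)"
     "\<bar>Im ((to_complex w + 1) powr of_real \<beta>)\<bar> \<le> \<beta> * A"
    if "w \<in> closure DT" for w
  proof -
    have x: "0 \<le> fst w" and y: "\<bar>snd w\<bar> \<le> A * fst w powr \<alpha>" using cl[OF that] by auto
    have "\<bar>Im ((to_complex w + 1) powr of_real \<beta>)\<bar> \<le> \<beta> * (fst w + 1) powr (\<beta> - 1) * \<bar>snd w\<bar>"
      using abs_Im_powr_of_real_le[of "to_complex w + 1" \<beta>] x \<beta> by simp
    also have "\<dots> \<le> \<beta> * (fst w + 1) powr (\<beta> - 1) * (A * (fst w + 1) powr \<alpha>)"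
    proof -
      have "A * fst w powr \<alpha> \<le> A * (fst w + 1) powr \<alpha>"
        using x A \<alpha> by (intro mult_left_mono powr_mono2) auto
      then show ?thesis using y \<beta> by (intro mult_left_mono) auto
    qed
    also have "\<dots> = \<beta> * A * ((fst w + 1) powr (\<beta> - 1) * (fst w + 1) powr \<alpha>)" by simp
    also have "(fst w + 1) powr (\<beta> - 1) * (fst w + 1) powr \<alpha> = 1"
      using x by (simp add: \<beta>_def powr_add[symmetric])
    finally show *: "\<bar>Im ((to_complex w + 1) powr of_real \<beta>)\<bar> \<le> \<beta> * A" by simp
    show "\<bar>\<kappa> * Im ((to_complex w + 1) powr of_real \<beta>)\<bar> \<le> (1 - \<epsilon>) * (pi / 2)"
      unfolding \<kappa>(2)[symmetric] using mult_left_mono[OF *, of \<kappa>] \<kappa>(1) by (simp add: abs_mult)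
  qed
  have ReF: "Re (F (to_complex w)) \<ge> \<gamma> * exp (\<kappa> * Re ((to_complex w + 1) powr of_real \<beta>))"
    if "w \<in> closure DT" for w
  proof -
    have "\<gamma> \<le> cos \<bar>\<kappa> * Im ((to_complex w + 1) powr of_real \<beta>)\<bar>"
      unfolding \<gamma>_def using Im_bound(1)[OF that] \<epsilon> mult_right_mono[of "1 - \<epsilon>" 1 "pi / 2"]
      by (intro cos_monotone_0_pi_le) auto
    then show ?thesis
      by (simp add: F_def Re_exp mult.commute[of \<gamma>])
  qed
  have F_hol: "F holomorphic_on U"
  proof -
    have "z + 1 \<notin> \<real>\<^sub>\<le>\<^sub>0" if "z \<in> U" for z
      using that by (auto simp: U_def complex_nonpos_Reals_iff)
    then show ?thesis unfolding F_def by (intro holomorphic_intros) auto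
  qed
  have open_U: "open U" by (auto simp: U_def intro!: open_Int open_halfspace_Re_gt)
  define Cb where "Cb = exp (\<kappa> * (R + 1) powr \<beta>)"
  have bdd: "\<bar>V w\<bar> \<le> Cb" for w
  proof (cases "to_complex w \<in> U")
    case True
    let ?z = "to_complex w"
    have "norm ?z < R" using True by (auto simp: U_def)
    then have "norm (?z + 1) \<le> R + 1" using norm_triangle_ineq[of ?z 1] by simp
    then have "norm ((?z + 1) powr of_real \<beta>) \<le> (R + 1) powr \<beta>"
      unfolding norm_powr_of_real using \<beta> by (intro powr_mono2) auto
    then have "Re ((?z + 1) powr of_real \<beta>) \<le> (R + 1) powr \<beta>"
      using complex_Re_le_cmod order_trans by blast
    then have "norm (F ?z) \<le> Cb"
      using \<kappa>(1) by (simp add: F_def Cb_def norm_exp_eq_Re)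
    then show ?thesis using True abs_Re_le_cmod[of "F ?z"] by (simp add: V_def)
  qed (simp add: V_def Cb_def)
  have contF: "continuous_on (to_complex -` U) (\<lambda>w. - Re (F (to_complex w)))"
    by (intro continuous_on_minus continuous_on_Re
        continuous_on_compose2[OF holomorphic_on_imp_continuous_on[OF F_hol]] continuous_on_to_complex continuous_on_id) auto
  have V_meas[measurable]: "V \<in> borel_measurable borel"
  proof -
    have "open (to_complex -` U)"
      using open_U by (intro open_vimage continuous_on_to_complex continuous_on_id)
    then have "(\<lambda>w. if w \<in> to_complex -` U then - Re (F (to_complex w)) else 0) \<in> borel_measurable borel"
      using contF by (intro borel_measurable_continuous_on_if) auto
    then show ?thesis by (simp add: V_def[abs_def])
  qed
  have contV: "continuous_on (closure DT) V"
  proof -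
    have "continuous_on (closure DT) (\<lambda>w. - Re (F (to_complex w)))"
      using contF by (rule continuous_on_subset) (use clU in auto)
    then show ?thesis
      by (subst continuous_on_cong[OF refl, where g = "\<lambda>w. - Re (F (to_complex w))"]) (auto simp: V_def clU)
  qed
  have sub: "submean_on K V" if "compact K" "K \<subseteq> DT" for K
  proof -
    have KU: "to_complex ` K \<subseteq> U" using that clU closure_subset by blast
    have "(\<lambda>z. - F z) holomorphic_on U" using F_hol by (rule holomorphic_on_minus)
    then have "\<exists>C\<ge>0. \<forall>w\<in>K. V w = Re (- F (to_complex w)) \<longrightarrow> (\<exists>a b. \<forall>v.
     V w + Re (a * to_complex v + b * (to_complex v)\<^sup>2) - C * norm v ^ 3 \<le> V (w + v))"
      by (rule submean_at_holomorphic[OF open_U _ that(1) KU bdd]) (simp add: V_def)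
    moreover have "V w = Re (- F (to_complex w))" if "w \<in> K" for w
      using that KU by (auto simp: V_def)
    ultimately show ?thesis unfolding submean_on_def by blast
  qed
  define E where "E n = {\<omega> \<in> space M. exit_time B D \<omega> \<le> ereal (real n) \<and> norm (exit_position B D \<omega>) > t}" for n :: nat
  have [measurable]: "exit_time B D \<in> borel_measurable M" "exit_position B D \<in> borel_measurable M"
    using open_D by (auto intro: measurable_exit_time_open measurable_exit_position)
  have E_sets[measurable]: "E n \<in> sets M" for n unfolding E_def by measurable
  \<comment> \<open>Lower bound for \<open>Re F\<close> on the line \<open>x = T\<close>: the power
    has modulus at least \<open>T powr \<beta>\<close> and imaginary part at most
    \<open>\<beta> * A\<close>, so its real part is at least the difference.\<close>
  define m where "m = \<gamma> * exp (\<kappa> * (T powr \<beta> - \<beta> * A))"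
  have m: "0 < m" using \<gamma> by (simp add: m_def)
  have start_in: "(1, 0) \<in> DT" using T A by (simp add: DT_def D_def parabola_domain_def)
  have E_le: "measure M (E n) \<le> exp (\<kappa> * 2 powr \<beta>) / m" if "n > 0" for n
  proof -
    let ?S = "\<lambda>\<omega>. B (stopped_time B DT (real n) \<omega>) \<omega>"
    have n: "0 < real n" using that by simp
    have [measurable]: "?S \<in> borel_measurable M"
      using open_DT n by (intro measurable_stopped_value) auto
    have "V (1, 0) \<le> expectation (\<lambda>\<omega>. V (?S \<omega>))"
      by (rule optional_stopping[OF open_DT start_in n V_meas bdd contV sub])
    moreover have "expectation (\<lambda>\<omega>. m * indicator (E n) \<omega>) \<le> expectation (\<lambda>\<omega>. - V (?S \<omega>))"
    proof (rule integral_mono_AE)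
      show "integrable M (\<lambda>\<omega>. m * indicator (E n) \<omega>)"
        by (intro integrable_mult_right integrable_real_indicator) (auto simp: emeasure_eq_measure)
      show "integrable M (\<lambda>\<omega>. - V (?S \<omega>))"
        using bdd by (intro integrable_const_bound[where B = Cb]) auto
      show "AE \<omega> in M. m * indicator (E n) \<omega> \<le> - V (?S \<omega>)"
        using start AE_space
      proof eventually_elim
        fix \<omega> assume \<omega>: "B 0 \<omega> = (1, 0)" "\<omega> \<in> space M"
        note path = continuous_paths[OF \<omega>(2)]
        have S: "?S \<omega> \<in> closure DT"
          using open_DT path \<omega> start_in n by (intro at_stopped_time_in_closure stopped_time_pos) auto
        then have V: "- V (?S \<omega>) = Re (F (to_complex (?S \<omega>)))" using clU by (simp add: V_def)
        show "m * indicator (E n) \<omega> \<le> - V (?S \<omega>)"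
        proof (cases "\<omega> \<in> E n")
          case False
          \<comment> \<open>Off \<open>E n\<close> only positivity of \<open>Re F\<close> is needed;
            this includes paths that have not left by time \<open>n\<close>.\<close>
          have "0 \<le> \<gamma> * exp (\<kappa> * Re ((to_complex (?S \<omega>) + 1) powr of_real \<beta>))" using \<gamma> by simp
          then show ?thesis using False ReF[OF S] V by simp
        next
          case True
          then have tau: "exit_time B D \<omega> \<le> ereal (real n)" and pos: "norm (exit_position B D \<omega>) > t"
            by (auto simp: E_def)
          define \<tau> where "\<tau> = stopped_time B D (real n) \<omega>"
          have \<tau>: "exit_time B D \<omega> = ereal \<tau>"
            using ereal_stopped_time[of "real n" B D \<omega>] tau by (simp add: \<tau>_def min_def)
          then have pos_eq: "exit_position B D \<omega> = B \<tau> \<omega>" by (simp add: exit_position_def)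
          have "B \<tau> \<omega> \<in> closure D"
            unfolding \<tau>_def using start_in
            n by (intro at_stopped_time_in_closure stopped_time_pos open_D path) (auto simp: \<omega> DT_def)
          then have x: "0 \<le> fst (B \<tau> \<omega>)" "\<bar>snd (B \<tau> \<omega>)\<bar> \<le> A * fst (B \<tau> \<omega>) powr \<alpha>"
            using closure_parabola_domain_subset[OF \<alpha>(1), of A] unfolding D_def by auto
          \<comment> \<open>With abscissa at most \<open>T\<close>, the exit position would have
            norm at most \<open>T + A * T powr \<alpha>\<close>, hence at most
            \<open>t\<close>.\<close>
          have far: "T < fst (B \<tau> \<omega>)"
          proof (rule ccontr)
            assume "\<not> ?thesis"
            then have "A * fst (B \<tau> \<omega>) powr \<alpha> \<le> A * T powr \<alpha>" "fst (B \<tau> \<omega>) \<le> T"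
              using x A \<alpha> by (auto intro!: mult_left_mono powr_mono2)
            then show False
              using norm_le_fst_add_snd[of "B \<tau> \<omega>"] x T pos unfolding pos_eq by simp
          qed
          have \<tau>_pos: "0 < \<tau>"
            unfolding \<tau>_def using start_in by (intro stopped_time_pos open_D path n) (auto simp: \<omega> DT_def)
          define \<sigma> where "\<sigma> = stopped_time B DT (real n) \<omega>"
          have \<sigma>_le: "\<sigma> \<le> \<tau>"
          proof -
            have "ereal \<sigma> \<le> ereal \<tau>"
              unfolding \<sigma>_def \<tau>_def using n exit_time_mono[of DT D B \<omega>]
              by (subst (1 2) ereal_stopped_time) (auto simp: DT_def intro: min.coboundedI1)
            then show ?thesis by simp
          qed
          have \<sigma>_pos: "0 < \<sigma>"
            unfolding \<sigma>_def using start_in by (intro stopped_time_pos open_DT path n) (auto simp: \<omega>)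
          \<comment> \<open>Leaving \<open>DT\<close> to the left of the line means leaving
            \<open>D\<close>, so \<open>\<sigma>\<close> would equal \<open>\<tau>\<close>; but the
            position at \<open>\<tau>\<close> lies beyond the line.\<close>
          have at_T: "fst (B \<sigma> \<omega>) = T"
          proof (rule ccontr)
            assume neq: "fst (B \<sigma> \<omega>) \<noteq> T"
            then have less: "fst (B \<sigma> \<omega>) < T" using cl(3)[OF S] by (simp add: \<sigma>_def)
            have "B \<tau> \<omega> \<notin> DT" using far by (simp add: DT_def)
            then have "exit_time B DT \<omega> \<le> ereal \<tau>"
              using \<tau>_pos exit_time_ge_iff by (meson exit_time_less_iff not_le order_less_le)
            moreover from this have "exit_time B DT \<omega> \<le> ereal (real n)"
              using tau \<tau> order_trans by metis
            ultimately have "exit_time B DT \<omega> = ereal \<sigma>"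
              using ereal_stopped_time[of "real n" B DT \<omega>] tau \<tau> n by (simp add: \<sigma>_def min_def)
            then have "B \<sigma> \<omega> \<notin> DT" by (rule notin_at_exit_time[of DT B \<omega>, OF open_DT path])
            then have "B \<sigma> \<omega> \<notin> D" using less by (simp add: DT_def)
            then have "\<not> \<sigma> < \<tau>"
              using \<sigma>_pos before_stopped_time[of "real n" \<sigma> B D \<omega>] by (auto simp: \<tau>_def)
            then have "\<sigma> = \<tau>" using \<sigma>_le by simp
            then show False using far less by simp
          qed
          let ?p = "(to_complex (?S \<omega>) + 1) powr of_real \<beta>"
          have "T powr \<beta> \<le> norm ?p"
          proof -
            have "T \<le> norm (to_complex (?S \<omega>) + 1)"
              using at_T complex_Re_le_cmod[of "to_complex (?S \<omega>) + 1"] by (simp add: \<sigma>_def)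
            then show ?thesis unfolding norm_powr_of_real using \<beta> T by (intro powr_mono2) auto
          qed
          also have "norm ?p \<le> \<bar>Re ?p\<bar> + \<bar>Im ?p\<bar>" by (rule cmod_le)
          also have "\<bar>Re ?p\<bar> = Re ?p"
            using Re_powr_of_real_nonneg[of "to_complex (?S \<omega>) + 1" \<beta>] at_T T \<beta> by (simp add: \<sigma>_def)
          also have "\<bar>Im ?p\<bar> \<le> \<beta> * A" by (rule Im_bound(2)[OF S])
          finally have "T powr \<beta> - \<beta> * A \<le> Re ?p" by simp
          then have "m \<le> \<gamma> * exp (\<kappa> * Re ?p)"
            unfolding m_def using \<gamma> \<kappa>(1) by simp
          then show ?thesis using True ReF[OF S] V by simp
        qed
      qed
    qed
    moreover have "V (1, 0) = - exp (\<kappa> * 2 powr \<beta>)"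
    proof -
      have "to_complex (1, 0) = 1" by (simp add: complex_eq_iff)
      then show ?thesis
        using clU[of "(1, 0)"] start_in closure_subset[of DT]
        by (auto simp: V_def F_def powr_of_real[of 2, simplified] exp_of_real simp flip: of_real_mult)
    qed
    ultimately have "m * measure M (E n) \<le> exp (\<kappa> * 2 powr \<beta>)" by simp
    then show ?thesis using m by (simp add: pos_le_divide_eq mult.commute)
  qed
  have "(\<lambda>n. measure M (E n)) \<longlonglongrightarrow> measure M (\<Union>n. E n)"
  proof (rule finite_Lim_measure_incseq)
    show "incseq E"
      by (auto simp: incseq_def E_def) (meson ereal_less_eq(3) of_nat_mono order_trans)
  qed auto
  then have "measure M (\<Union>n. E n) \<le> exp (\<kappa> * 2 powr \<beta>) / m"
    by (rule LIMSEQ_le_const2) (intro exI[of _ 1] allI impI E_le, simp)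
  moreover have "(\<Union>n. E n) = {\<omega> \<in> space M. exit_time B D \<omega> < \<infinity> \<and> norm (exit_position B D \<omega>) > t}"
  proof (intro equalityI subsetI)
    fix \<omega> assume \<omega>: "\<omega> \<in> {\<omega> \<in> space M. exit_time B D \<omega> < \<infinity> \<and> norm (exit_position B D \<omega>) > t}"
    then obtain r where "exit_time B D \<omega> = ereal r"
      using exit_time_nonneg[of B D \<omega>] by (cases "exit_time B D \<omega>") auto
    moreover obtain n where "r \<le> real n" using real_arch_simple by blast
    ultimately show "\<omega> \<in> (\<Union>n. E n)" using \<omega> by (auto simp: E_def)
  next
    fix \<omega> assume "\<omega> \<in> (\<Union>n. E n)"
    then show "\<omega> \<in> {\<omega> \<in> space M. exit_time B D \<omega> < \<infinity> \<and> norm (exit_position B D \<omega>) > t}"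
      by (auto simp: E_def intro: le_less_trans)
  qed
  moreover have "exp (\<kappa> * 2 powr \<beta>) / m
    = exp (\<kappa> * (2 powr \<beta> + \<beta> * A)) / \<gamma> * exp (- \<kappa> * T powr \<beta>)"
  proof -
    have "exp (\<kappa> * 2 powr \<beta>) = exp (\<kappa> * (2 powr \<beta> + \<beta> * A)) * exp (- \<kappa> * T powr \<beta>) * exp (\<kappa> * (T powr \<beta> - \<beta> * A))"
      unfolding exp_add[symmetric] by (simp add: algebra_simps)
    then show ?thesis using \<gamma> by (simp add: m_def)
  qed
  ultimately show ?thesis by (simp add: \<beta>_def \<gamma>_def)
qed

section \<open>The lower bound\<close>

text \<open>Concavity of the power, obtained as weighted arithmetic-geometric mean of
  \<open>1 + s / t\<close> and 1.\<close>

lemma powr_add_le_tangent: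
  fixes t s b :: real
  assumes "0 < t" "0 \<le> s" "0 < b" "b < 1"
  shows "(t + s) powr b \<le> t powr b + b * t powr (b - 1) * s"
proof -
  have "(1 + s / t) powr b * 1 powr (1 - b) \<le> b * (1 + s / t) + (1 - b) * 1"
    using assms by (intro Youngs_inequality_0) (auto intro: add_pos_nonneg)
  then have "t powr b * (1 + s / t) powr b \<le> t powr b * (1 + b * (s / t))"
    by (intro mult_left_mono) (auto simp: algebra_simps)
  also have "t powr b * (1 + s / t) powr b = (t + s) powr b"
    using assms by (subst powr_mult[symmetric]) (auto simp: distrib_left)
  also have "t powr b * (1 + b * (s / t)) = t powr b + b * t powr (b - 1) * s"
    using assms by (simp add: powr_diff field_simps)
  finally show ?thesis .
qed

text \<open>The Taylor expansions of sine and cosine lose a factor \<open>1 - O(\<theta>\<^sup>2)\<close>, which the term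
  \<open>3 A\<^sup>2 / R\<close> recovers since \<open>R\<close> is essentially at least \<open>A / \<theta>\<close>.\<close>

lemma sin_mult_ge_of_parabola:
  fixes \<theta> \<beta> A R :: real
  assumes \<theta>: "0 < \<theta>" "\<theta> < pi / 2" and \<beta>: "0 < \<beta>" "\<beta> < 1" and A: "0 < A" and R: "0 < R"
    and le: "A * cos \<theta> powr (1 - \<beta>) \<le> R * sin \<theta>"
  shows "A * \<beta> \<le> sin (\<beta> * \<theta>) * (R + 3 * A\<^sup>2 / R)"
proof -
  define s where "s = \<theta>\<^sup>2"
  have s: "0 < s" "s < 4"
  proof -
    have "\<theta> < 2" using \<theta> pi_less_4 by simp
    then have "\<theta>\<^sup>2 < 2\<^sup>2" using \<theta> by (intro power_strict_mono) auto
    then show "0 < s" "s < 4" using \<theta> by (auto simp: s_def)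
  qed
  have cos_pos: "0 < cos \<theta>" using \<theta> by (intro cos_gt_zero) auto
  have "1 - s / 2 \<le> cos \<theta>"
  proof -
    have "\<bar>sin (\<theta> / 2)\<bar>\<^sup>2 \<le> \<bar>\<theta> / 2\<bar>\<^sup>2"
      by (intro power_mono abs_sin_x_le_abs_x) auto
    then show ?thesis
      using cos_double_sin[of "\<theta> / 2"] by (simp add: s_def power_divide)
  qed
  also have "\<dots> \<le> cos \<theta> powr (1 - \<beta>)"
    using powr_mono'[of "1 - \<beta>" 1 "cos \<theta>"] cos_pos \<beta> by simp
  finally have "A * (1 - s / 2) \<le> R * sin \<theta>" using le A by (meson mult_left_mono less_imp_le order_trans)
  also have "\<dots> \<le> R * \<theta>" using R sin_x_le_x[of \<theta>] \<theta> by (intro mult_left_mono) auto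
  finally have AR: "A * (1 - s / 2) \<le> R * \<theta>" .
  \<comment> \<open>The scale-free variable: \<open>\<theta> * (R + 3 * A\<^sup>2 / R)\<close>
    equals \<open>A * (Y + 3 * s / Y)\<close>, so only \<open>s\<close> and \<open>Y\<close>
    remain.\<close>
  define Y where "Y = R * \<theta> / A"
  have Y: "0 < Y" "1 - s / 2 \<le> Y" using AR A R \<theta> by (auto simp: Y_def field_simps)
  \<comment> \<open>For large \<open>Y\<close> the first summand alone suffices. Otherwise
    \<open>Y\<close> lies within \<open>s / 2\<close> of 1, and each summand is bounded at its worse
    end. With the constant 3 the excess in the second case has the factor \<open>4 - s\<close>, as
    in the first, so the crude bound \<open>s < 4\<close> settles both.\<close>
  have key: "1 \<le> (1 - s / 6) * (Y + 3 * s / Y)"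
  proof (cases "1 + s / 2 \<le> Y")
    case True
    have "1 \<le> (1 - s / 6) * (1 + s / 2)"
    proof -
      have "(1 - s / 6) * (1 + s / 2) - 1 = s * (4 - s) / 12" by (simp add: field_simps power2_eq_square)
      moreover have "0 \<le> s * (4 - s) / 12" using s by simp
      ultimately show ?thesis by linarith
    qed
    also have "\<dots> \<le> (1 - s / 6) * (Y + 3 * s / Y)"
      using True s Y by (intro mult_left_mono add_increasing2) auto
    finally show ?thesis .
  next
    case False
    have "1 \<le> (1 - s / 6) * ((1 - s / 2) + 3 * s / (1 + s / 2))"
    proof -
      have "(1 - s / 6) * ((1 - s / 2) + 3 * s / (1 + s / 2)) - 1
          = s * ((4 - s) * (14 - s)) / (24 * (1 + s / 2))"
        using s by (simp add: divide_simps) (simp add: algebra_simps power2_eq_square power3_eq_cube)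
      moreover have "0 \<le> s * ((4 - s) * (14 - s)) / (24 * (1 + s / 2))"
        using s by (intro divide_nonneg_nonneg mult_nonneg_nonneg) auto
      ultimately show ?thesis by linarith
    qed
    also have "\<dots> \<le> (1 - s / 6) * (Y + 3 * s / Y)"
      using False s Y by (intro mult_left_mono add_mono divide_left_mono) auto
    finally show ?thesis .
  qed
  have "\<beta> * \<theta> * (1 - s / 6) \<le> sin (\<beta> * \<theta>)"
  proof -
    have "\<bar>sin (\<beta> * \<theta>) - \<beta> * \<theta>\<bar> \<le> \<bar>\<beta> * \<theta>\<bar> ^ 3 / 6"
      using Maclaurin_sin_bound[of "\<beta> * \<theta>" 3]
      by (simp add: numeral_3_eq_3 sin_coeff_def fact_numeral)
    moreover have "\<bar>\<beta> * \<theta>\<bar> = \<beta> * \<theta>" using \<theta> \<beta> by simp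
    ultimately have "\<beta> * \<theta> - (\<beta> * \<theta>) ^ 3 / 6 \<le> sin (\<beta> * \<theta>)"
      using abs_ge_minus_self[of "sin (\<beta> * \<theta>) - \<beta> * \<theta>"] by (simp only:)
    moreover have "(\<beta> * \<theta>) ^ 3 \<le> \<beta> * \<theta> ^ 3"
    proof -
      have "\<beta> ^ 3 \<le> \<beta> ^ 1" using \<beta> by (intro power_decreasing) auto
      then show ?thesis using \<theta> by (simp add: power_mult_distrib mult_right_mono)
    qed
    ultimately show ?thesis by (simp add: s_def algebra_simps power2_eq_square power3_eq_cube)
  qed
  then have "\<beta> * \<theta> * (1 - s / 6) * (R + 3 * A\<^sup>2 / R) \<le> sin (\<beta> * \<theta>) * (R + 3 * A\<^sup>2 / R)"
    using R by (intro mult_right_mono) auto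
  moreover have "\<beta> * \<theta> * (1 - s / 6) * (R + 3 * A\<^sup>2 / R) = (A * \<beta>) * ((1 - s / 6) * (Y + 3 * s / Y))"
  proof -
    have "\<theta> * (R + 3 * A\<^sup>2 / R) = A * (Y + 3 * s / Y)"
      using A R \<theta> by (simp add: Y_def s_def field_simps power2_eq_square)
    then have "\<beta> * (1 - s / 6) * (\<theta> * (R + 3 * A\<^sup>2 / R)) = \<beta> * (1 - s / 6) * (A * (Y + 3 * s / Y))"
      by simp
    then show ?thesis by (simp only: mult_ac)
  qed
  moreover have "(A * \<beta>) * 1 \<le> (A * \<beta>) * ((1 - s / 6) * (Y + 3 * s / Y))"
    using key A \<beta> by (intro mult_left_mono) auto
  ultimately show ?thesis by simp
qed

text \<open>The preimage of the strip \<open>|Im z| < pi / 2\<close> under this map is a horn inside the domain with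
  asymptotically the same width up to a relative error that is integrable in the exponent.\<close>

definition horn_map :: "real \<Rightarrow> real \<Rightarrow> complex \<Rightarrow> complex" where
  "horn_map A \<beta> z = of_real (pi / (2 * A * \<beta>)) * (z powr of_real \<beta> - of_real (3 * A\<^sup>2) / z powr of_real \<beta>)"

text \<open>Inversion reverses the phase, so subtracting the reciprocal power enlarges the imaginary
  part and lowers the real part.\<close>

lemma horn_map_polar:
  assumes "z \<noteq> 0"
  shows "Re (horn_map A \<beta> z) = pi / (2 * A * \<beta>) * cos (\<beta> * Arg z) * (norm z powr \<beta> - 3 * A\<^sup>2 / norm z powr \<beta>)"
    and "Im (horn_map A \<beta> z) = pi / (2 * A * \<beta>) * sin (\<beta> * Arg z) * (norm z powr \<beta> + 3 * A\<^sup>2 / norm z powr \<beta>)"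
proof -
  define R where "R = norm z powr \<beta>"
  define K where "K = 3 * A\<^sup>2 / R"
  define c where "c = pi / (2 * A * \<beta>)"
  define e where "e = exp (\<i> * of_real (\<beta> * Arg z))"
  have e: "Re e = cos (\<beta> * Arg z)" "Im e = sin (\<beta> * Arg z)" "inverse e = cnj e"
    by (auto simp: e_def Re_exp Im_exp exp_cnj exp_minus[symmetric])
  have "z powr of_real \<beta> = of_real R * e"
    using assms by (simp add: powr_of_real_polar R_def e_def)
  moreover have "of_real (3 * A\<^sup>2) / (of_real R * e) = of_real K * inverse e"
    unfolding K_def by (simp add: divide_inverse)
  ultimately have "horn_map A \<beta> z = of_real c * (of_real R * e - of_real K * inverse e)"
    unfolding horn_map_def c_def by (simp only:)
  then have "Re (horn_map A \<beta> z) = c * (R * Re e - K * Re e)"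
    "Im (horn_map A \<beta> z) = c * (R * Im e + K * Im e)"
    unfolding e(3) by simp_all
  then show "Re (horn_map A \<beta> z) = pi / (2 * A * \<beta>) * cos (\<beta> * Arg z) * (norm z powr \<beta> - 3 * A\<^sup>2 / norm z powr \<beta>)"
    and "Im (horn_map A \<beta> z) = pi / (2 * A * \<beta>) * sin (\<beta> * Arg z) * (norm z powr \<beta> + 3 * A\<^sup>2 / norm z powr \<beta>)"
    unfolding e R_def[symmetric] K_def[symmetric] c_def[symmetric] by (simp_all add: algebra_simps)
qed

text \<open>By contraposition: off the domain, dividing the boundary inequality by
  \<open>norm z powr (1 - \<beta>)\<close> gives the hypothesis of
  \<open>sin_mult_ge_of_parabola\<close>, whose conclusion says that the phase has reached
  \<open>pi / 2\<close>. Symmetry in the sign of \<open>Arg z\<close> reduces to a positive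
  angle.\<close>

lemma horn_subset_parabola_domain:
  assumes \<beta>: "0 < \<beta>" "\<beta> < 1" and A: "0 < A" and z: "0 < Re z"
    and Im: "\<bar>Im (horn_map A \<beta> z)\<bar> < pi / 2"
  shows "\<bar>Im z\<bar> < A * Re z powr (1 - \<beta>)"
proof (rule ccontr)
  assume "\<not> ?thesis"
  then have out: "A * Re z powr (1 - \<beta>) \<le> \<bar>Im z\<bar>" by simp
  have nz: "z \<noteq> 0" using z by auto
  define \<theta> where "\<theta> = \<bar>Arg z\<bar>"
  define r where "r = norm z"
  define R where "R = r powr \<beta>"
  have r: "0 < r" and R: "0 < R" using nz by (auto simp: r_def R_def)
  have Re_z: "Re z = r * cos \<theta>" and Im_z: "\<bar>Im z\<bar> = r * \<bar>sin (Arg z)\<bar>"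
    using nz by (auto simp: r_def \<theta>_def cos_Arg sin_Arg)
  have \<theta>2: "\<theta> < pi / 2" using abs_Arg_less[OF z] by (simp add: \<theta>_def)
  have sin_abs: "\<bar>sin (b * Arg z)\<bar> = sin (b * \<theta>)" if "0 < b" "b \<le> 1" for b
  proof -
    have "0 \<le> b * \<theta>" "b * \<theta> \<le> pi"
      using that \<theta>2 mult_mono[of b 1 \<theta> pi] by (auto simp: \<theta>_def)
    then have "0 \<le> sin (b * \<theta>)" by (rule sin_ge_zero)
    then show ?thesis by (cases "Arg z \<ge> 0") (auto simp: \<theta>_def)
  qed
  have "0 < A * Re z powr (1 - \<beta>)" using A z by simp
  then have "Arg z \<noteq> 0" using out Im_z by auto
  then have \<theta>1: "0 < \<theta>" by (simp add: \<theta>_def)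
  have cos_pos: "0 < cos \<theta>" using \<theta>1 \<theta>2 by (intro cos_gt_zero) auto
  have "A * cos \<theta> powr (1 - \<beta>) \<le> R * sin \<theta>"
  proof -
    have "A * (r powr (1 - \<beta>) * cos \<theta> powr (1 - \<beta>)) \<le> r * sin \<theta>"
      using out Im_z sin_abs[of 1] r cos_pos by (simp add: Re_z powr_mult)
    moreover have "r = r powr (1 - \<beta>) * R"
      using r by (simp add: R_def powr_add[symmetric])
    ultimately have "r powr (1 - \<beta>) * (A * cos \<theta> powr (1 - \<beta>)) \<le> r powr (1 - \<beta>) * (R * sin \<theta>)"
      by (metis mult.assoc mult.left_commute)
    then show ?thesis using r by simp
  qed
  then have "A * \<beta> \<le> sin (\<beta> * \<theta>) * (R + 3 * A\<^sup>2 / R)"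
    using \<theta>1 \<theta>2 \<beta> A R by (intro sin_mult_ge_of_parabola)
  then have "pi / (2 * A * \<beta>) * (A * \<beta>) \<le> pi / (2 * A * \<beta>) * (sin (\<beta> * \<theta>) * (R + 3 * A\<^sup>2 / R))"
    using A \<beta> by (intro mult_left_mono) auto
  moreover have "\<bar>Im (horn_map A \<beta> z)\<bar> = pi / (2 * A * \<beta>) * (sin (\<beta> * \<theta>) * (R + 3 * A\<^sup>2 / R))"
    using sin_abs[of \<beta>] \<beta> A R by (simp add: horn_map_polar(2)[OF nz] abs_mult R_def r_def)
  ultimately show False using Im A \<beta> by simp
qed

lemma horn_map_holomorphic: "horn_map A \<beta> holomorphic_on {z. 0 < Re z}"
proof -
  have "z \<notin> \<real>\<^sub>\<le>\<^sub>0" "z \<noteq> 0" if "z \<in> {z. 0 < Re z}" for z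
    using that by (auto simp: complex_nonpos_Reals_iff)
  then show ?thesis
    unfolding horn_map_def[abs_def] by (intro holomorphic_intros) auto
qed

text \<open>The subtracted term tends to infinity at the origin; it makes the exponential of the map
  vanish at the apex of the domain, whatever the direction of approach.\<close>

lemma Re_horn_map_le:
  assumes "0 < Re z" "0 < \<beta>" "\<beta> < 1" "0 < A"
  shows "Re (horn_map A \<beta> z) \<le> pi / (2 * A * \<beta>) * norm z powr \<beta>
    - pi / (2 * A * \<beta>) * cos (\<beta> * (pi / 2)) * 3 * A\<^sup>2 / norm z powr \<beta>"
proof -
  have nz: "z \<noteq> 0" using assms by auto
  have \<theta>: "\<bar>\<beta> * Arg z\<bar> \<le> \<beta> * (pi / 2)"
    using abs_Arg_less[OF assms(1)] assms by (simp add: abs_mult)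
  have "cos (\<beta> * (pi / 2)) \<le> cos \<bar>\<beta> * Arg z\<bar>"
    using \<theta> assms mult_right_mono[of \<beta> 1 "pi/2"] pi_gt_zero by (intro cos_monotone_0_pi_le) auto
  then have c: "cos (\<beta> * (pi / 2)) \<le> cos (\<beta> * Arg z)" by simp
  let ?R = "norm z powr \<beta>"
  have "cos (\<beta> * Arg z) * ?R - cos (\<beta> * Arg z) * (3 * A\<^sup>2 / ?R) \<le> 1 * ?R - cos (\<beta> * (pi / 2)) * (3 * A\<^sup>2 / ?R)"
    using c by (intro diff_mono mult_right_mono) auto
  from mult_left_mono[OF this, of "pi / (2 * A * \<beta>)"] show ?thesis
    using assms by (simp add: horn_map_polar(1)[OF nz] right_diff_distrib mult_ac)
qed

section \<open>Continuous cut-off and escape from bounded sets\<close>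

text \<open>Clamping the phase restricts the cosine to its central arch and continues it by 0,
  continuously and without sign changes.\<close>

lemma cos_clamp_nonneg: "0 \<le> cos (max (- (pi / 2)) (min (pi / 2) s))"
  by (rule cos_ge_zero) (auto simp: max_def min_def)

lemma cos_clamp_eq:
  assumes "\<bar>s\<bar> < pi / 2"
  shows "cos (max (- (pi / 2)) (min (pi / 2) s)) = cos s"
proof -
  have "- (pi / 2) \<le> s" "s \<le> pi / 2" using assms by linarith+
  then show ?thesis by (simp add: max_absorb2 min_absorb2)
qed

lemma cos_clamp_eq_0:
  assumes "\<not> \<bar>s\<bar> < pi / 2"
  shows "cos (max (- (pi / 2)) (min (pi / 2) s)) = 0"
proof (cases "pi / 2 \<le> s")
  case True
  have "- (pi / 2) \<le> pi / 2" by simp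
  then show ?thesis using True by (simp add: max_absorb2 min_absorb1 del: divide_minus_left)
next
  case False
  then have "s \<le> - (pi / 2)" "s \<le> pi / 2" using assms by linarith+
  then show ?thesis by (simp add: max_absorb1 min_absorb2 del: divide_minus_left)
qed

text \<open>Each coordinate density is at most \<open>1 / sqrt n\<close>. The bound serves to
  discard paths that are still in a bounded part of the domain at a late time
  \<open>n\<close>.\<close>

lemma (in planar_brownian_motion) prob_bounded_increment:
  assumes "0 < n" and S: "S \<in> sets borel" "emeasure lborel S < \<infinity>"
  shows "prob {\<omega> \<in> space M. B n \<omega> - B 0 \<omega> \<in> S} \<le> measure lborel S / n"
proof -
  let ?f = "\<lambda>(x, y). ennreal (normal_density 0 (sqrt n) x * normal_density 0 (sqrt n) y)"
  have dist: "distributed M lborel (\<lambda>\<omega>. B n \<omega> - B 0 \<omega>) ?f"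
    using gaussian_increments[of 0 n] assms by simp
  have nd: "normal_density 0 (sqrt n) x \<le> 1 / sqrt n" for x
  proof -
    have "1 * n \<le> 2 * pi * n" using pi_gt3 assms(1) by (intro mult_right_mono) auto
    then have "sqrt n \<le> sqrt (2 * pi * n)" by simp
    then have "1 / sqrt (2 * pi * n) \<le> 1 / sqrt n"
      using assms(1) by (intro divide_left_mono) auto
    moreover have "normal_density 0 (sqrt n) x \<le> 1 / sqrt (2 * pi * n) * 1"
      unfolding normal_density_def using assms(1) by (intro mult_mono) auto
    ultimately show ?thesis by simp
  qed
  have f_le: "?f w \<le> ennreal (1 / n)" for w
  proof -
    have "normal_density 0 (sqrt n) (fst w) * normal_density 0 (sqrt n) (snd w) \<le> 1 / sqrt n * (1 / sqrt n)"
      by (intro mult_mono nd normal_density_nonneg) (use assms(1) in auto)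
    then show ?thesis using assms(1) by (auto simp: split_def intro!: ennreal_leI)
  qed
  have "emeasure M ((\<lambda>\<omega>. B n \<omega> - B 0 \<omega>) -` S \<inter> space M) = (\<integral>\<^sup>+w. ?f w * indicator S w \<partial>lborel)"
    using S by (intro distributed_emeasure[OF dist]) simp
  also have "\<dots> \<le> (\<integral>\<^sup>+w. ennreal (1 / n) * indicator S w \<partial>lborel)"
    using f_le by (intro nn_integral_mono mult_right_mono) auto
  also have "\<dots> = ennreal (1 / n) * emeasure lborel S"
    using S by (simp add: nn_integral_cmult_indicator)
  also have "\<dots> = ennreal (measure lborel S / n)"
    using S assms(1) by (simp add: emeasure_eq_ennreal_measure ennreal_mult[symmetric])
  finally have "emeasure M ((\<lambda>\<omega>. B n \<omega> - B 0 \<omega>) -` S \<inter> space M) \<le> ennreal (measure lborel S / n)" .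
  moreover have "(\<lambda>\<omega>. B n \<omega> - B 0 \<omega>) -` S \<inter> space M = {\<omega> \<in> space M. B n \<omega> - B 0 \<omega> \<in> S}" by auto
  ultimately show ?thesis
    using assms(1) by (simp add: emeasure_eq_measure)
qed

text \<open>The test function is bounded, vanishes on the boundary of the domain up to distance \<open>t\<close>
  from the origin, and is locally a maximum of harmonic functions: up to \<open>x = t + 2 L\<close> the
  exponential \<open>V1\<close> carries the exact decay rate, and near \<open>x = t + 2 L\<close> it is dominated by the
  harmonic quadratic \<open>V2\<close>, which confines the support to \<open>x < t + 4 L\<close>.  Here \<open>L\<close> exceeds
  the half-width of the domain up to \<open>x = t + 4 L\<close>.\<close>

lemma exit_tail_lower_explicit:
  fixes \<alpha> A t :: real
  assumes \<alpha>: "0 < \<alpha>" "\<alpha> < 1" and A: "0 < A"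
    and t: "1 < t" "8 * A * t powr \<alpha> \<le> t"
    and BM: "planar_brownian_motion M B (1, 0)"
  defines "D \<equiv> parabola_domain A \<alpha>" and "c \<equiv> pi / (2 * A * (1 - \<alpha>))"
  shows "exp (c * (1 - 3 * A\<^sup>2) - 4 * pi) / 4 * exp (- c * t powr (1 - \<alpha>))
    \<le> measure M {\<omega> \<in> space M. exit_time B D \<omega> < \<infinity> \<and> norm (exit_position B D \<omega>) > t}"
proof -
  interpret planar_brownian_motion M B "(1, 0)" by (rule BM)
  define \<beta> where "\<beta> = 1 - \<alpha>"
  have \<beta>: "0 < \<beta>" "\<beta> < 1" "1 - \<beta> = \<alpha>" using \<alpha> by (auto simp: \<beta>_def)
  have c: "0 < c" "c = pi / (2 * A * \<beta>)" using \<alpha> A by (auto simp: c_def \<beta>_def)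
  \<comment> \<open>Since \<open>4 * L \<le> t\<close>, the abscissas up to \<open>t + 4 * L\<close>
    are at most \<open>2 * t\<close>, and doubling the abscissa widens the domain by a factor below
    2.\<close>
  define L where "L = 2 * A * t powr \<alpha>"
  have L: "0 < L" "4 * L \<le> t" using A t by (auto simp: L_def)
  have width: "A * x powr \<alpha> < L" if "0 \<le> x" "x \<le> t + 4 * L" for x
  proof -
    have "x powr \<alpha> \<le> (2 * t) powr \<alpha>" using that L \<alpha> by (intro powr_mono2) auto
    also have "\<dots> = 2 powr \<alpha> * t powr \<alpha>" using t by (simp add: powr_mult)
    also have "\<dots> < 2 * t powr \<alpha>"
    proof -
      have "(2::real) powr \<alpha> < 2 powr 1" using \<alpha> by (intro powr_less_mono) auto
      then show ?thesis using t by simp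
    qed
    finally show ?thesis using A by (simp add: L_def)
  qed
  define P where "P = horn_map A \<beta>"
  \<comment> \<open>Normalises the exponential to at most 1 for abscissas below
    \<open>t + 3 * L\<close>: with height below \<open>L\<close>, such points have norm below
    \<open>t + 4 * L\<close>.\<close>
  define \<epsilon> where "\<epsilon> = exp (- c * (t + 4 * L) powr \<beta>)"
  \<comment> \<open>The jump to 0 at \<open>t + 2 * L\<close> is invisible in \<open>V\<close>,
    where \<open>V2\<close> is at least 2 and the exponential at most 1.\<close>
  define V1 where "V1 z = (if 0 < Re z \<and> Re z < t + 2 * L
    then \<epsilon> * exp (Re (P z)) * cos (max (- (pi / 2)) (min (pi / 2) (Im (P z)))) else 0)" for z
  \<comment> \<open>With \<open>x' = x - t\<close> and \<open>\<bar>y\<bar> < L\<close> the real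
    part is positive only for \<open>0 < x' < 4 * L\<close>, never exceeds 4, and is at least 2 for
    \<open>x'\<close> between \<open>L\<close> and \<open>3 * L\<close>.\<close>
  define V2 where "V2 z = Re ((- (z - of_real t)\<^sup>2 + of_real (4 * L) * (z - of_real t) - of_real (L\<^sup>2)) / of_real (L\<^sup>2))" for z :: complex
  define V where "V w = (if \<bar>snd w\<bar> < L then max (V1 (to_complex w)) (V2 (to_complex w)) else 0)" for w
  have V2_eq: "V2 z = ((Im z)\<^sup>2 - L\<^sup>2 + (Re z - t) * (4 * L - (Re z - t))) / L\<^sup>2" for z
    using L by (simp add: V2_def power2_eq_square algebra_simps)
  have in_D_iff: "w \<in> D \<longleftrightarrow> 0 < fst w \<and> \<bar>snd w\<bar> < A * fst w powr \<alpha>" for w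
    by (auto simp: D_def parabola_domain_def)
  have horn: "w \<in> D" if "0 < fst w" "\<bar>Im (P (to_complex w))\<bar> < pi / 2" for w
    using horn_subset_parabola_domain[of \<beta> A "to_complex w"] that \<beta> A by (simp add: P_def in_D_iff)
  have V1_nonneg: "0 \<le> V1 z" for z
    using cos_clamp_nonneg by (simp add: V1_def \<epsilon>_def)
  have V1_nz: "0 < fst w" "fst w < t + 2 * L" "\<bar>Im (P (to_complex w))\<bar> < pi / 2" "w \<in> D"
    if "V1 (to_complex w) \<noteq> 0" for w
  proof -
    show *: "0 < fst w" "fst w < t + 2 * L" using that by (auto simp: V1_def split: if_splits)
    show **: "\<bar>Im (P (to_complex w))\<bar> < pi / 2"
      using that cos_clamp_eq_0[of "Im (P (to_complex w))"] by (auto simp: V1_def split: if_splits)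
    show "w \<in> D" using * ** by (intro horn)
  qed
  have exp_le_1: "\<epsilon> * exp (Re (P (to_complex w))) \<le> 1" if "w \<in> D" "fst w < t + 3 * L" for w
  proof -
    let ?z = "to_complex w"
    have x: "0 < fst w" and y: "\<bar>snd w\<bar> < L" using that width[of "fst w"] L by (auto simp: in_D_iff)
    have "0 \<le> cos (\<beta> * (pi / 2))"
      using \<beta> mult_right_mono[of \<beta> 1 "pi/2"] by (intro cos_ge_zero) (auto intro: order_trans[of _ 0])
    then have "Re (P ?z) \<le> c * norm ?z powr \<beta>"
      using Re_horn_map_le[of ?z \<beta> A] x \<beta> A unfolding P_def c(2)
      by (smt (verit) Re_to_complex divide_nonneg_nonneg mult_nonneg_nonneg pi_ge_zero powr_ge_zero zero_le_power2)
    also have "\<dots> \<le> c * (t + 4 * L) powr \<beta>"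
      using norm_le_fst_add_snd[of w] x y that c(1) \<beta> by (intro mult_left_mono powr_mono2) auto
    finally show ?thesis by (simp add: \<epsilon>_def exp_add[symmetric])
  qed
  have V1_le_1: "V1 (to_complex w) \<le> 1" for w
  proof (cases "V1 (to_complex w) = 0")
    case False
    note nz = V1_nz[OF this]
    have "\<epsilon> * exp (Re (P (to_complex w))) * cos (Im (P (to_complex w))) \<le> 1 * 1"
      using exp_le_1[OF nz(4)] nz L cos_clamp_nonneg[of "Im (P (to_complex w))"] cos_clamp_eq[OF nz(3)]
      by (intro mult_mono) auto
    then show ?thesis using nz cos_clamp_eq[OF nz(3)] by (simp add: V1_def)
  qed simp
  have sq_less: "(snd w)\<^sup>2 < L\<^sup>2" if "\<bar>snd w\<bar> < L" for w :: "real \<times> real"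
    using power_strict_mono[OF that, of 2] by simp
  have V2_le_4: "V2 (to_complex w) \<le> 4" if "\<bar>snd w\<bar> < L" for w
  proof -
    have "(fst w - t) * (4 * L - (fst w - t)) \<le> 4 * L\<^sup>2"
      using zero_le_power2[of "fst w - t - 2 * L"] by (simp add: power2_eq_square algebra_simps)
    then show ?thesis using sq_less[OF that] L by (simp add: V2_eq pos_divide_le_eq)
  qed
  have V2_ge_2: "2 \<le> V2 (to_complex w)" if "t + L \<le> fst w" "fst w \<le> t + 3 * L" for w
  proof -
    have "0 \<le> (fst w - t - L) * (3 * L - (fst w - t))"
      using that by (intro mult_nonneg_nonneg) auto
    then have "3 * L\<^sup>2 \<le> (fst w - t) * (4 * L - (fst w - t))"
      by (simp add: power2_eq_square algebra_simps)
    then show ?thesis using L by (simp add: V2_eq pos_le_divide_eq add_increasing)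
  qed
  have V2_neg: "V2 (to_complex w) < 0" if "\<bar>snd w\<bar> < L" "fst w \<le> t \<or> t + 4 * L \<le> fst w" for w
  proof -
    have "(fst w - t) * (4 * L - (fst w - t)) \<le> 0"
      using that(2) L by (auto simp: mult_le_0_iff)
    then show ?thesis using sq_less[OF that(1)] L by (simp add: V2_eq divide_less_0_iff)
  qed
  have V_nonneg: "0 \<le> V w" for w using V1_nonneg[of "to_complex w"] by (simp add: V_def max.coboundedI1)
  have V_le: "V w \<le> 4" for w
    using V1_le_1[of w] V2_le_4[of w] by (simp add: V_def)
  have bdd: "\<bar>V w\<bar> \<le> 4" for w using V_nonneg V_le by simp
  have V_nz: "\<bar>snd w\<bar> < L" "0 < fst w" "fst w < t + 4 * L" if "V w \<noteq> 0" for w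
  proof -
    show y: "\<bar>snd w\<bar> < L" using that by (auto simp: V_def split: if_splits)
    have "V1 (to_complex w) \<noteq> 0 \<or> 0 < V2 (to_complex w)"
      using that y by (auto simp: V_def max_def split: if_splits)
    then show "0 < fst w" "fst w < t + 4 * L"
      using V1_nz[of w] V2_neg[OF y] L t by force+
  qed
  \<comment> \<open>To the left of \<open>t\<close> the barrier is negative and off the domain the
    horn function vanishes, so a nonzero value at an exit certifies a far exit.\<close>
  have V_outside: "t < fst w" if "w \<notin> D" "V w \<noteq> 0" for w
  proof (rule ccontr)
    assume "\<not> ?thesis"
    moreover have "V1 (to_complex w) = 0" using V1_nz(4)[of w] that(1) by blast
    ultimately show False using V2_neg[OF V_nz(1)[OF that(2)]] that(2) by (auto simp: V_def split: if_splits)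
  qed
  have open_D: "open D" unfolding D_def using \<alpha> by (intro open_parabola_domain) auto
  have clD: "0 \<le> fst w" "\<bar>snd w\<bar> \<le> A * fst w powr \<alpha>" if "w \<in> closure D" for w
    using closure_parabola_domain_subset[OF \<alpha>(1), of A] that unfolding D_def by auto
  have P_cont: "continuous_on {z. 0 < Re z} P"
    unfolding P_def using horn_map_holomorphic by (rule holomorphic_on_imp_continuous_on)
  have Pc_cont: "continuous_on {w. 0 < fst w} (\<lambda>w. P (to_complex w))"
    by (rule continuous_on_compose2[OF P_cont]) (auto intro: continuous_intros)
  define Q where "Q w = (if 0 < fst w
    then \<epsilon> * exp (Re (P (to_complex w))) * cos (max (- (pi / 2)) (min (pi / 2) (Im (P (to_complex w))))) else 0)" for w
  have Q_cont_pos: "continuous_on {w. 0 < fst w} Q"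
  proof -
    have "continuous_on {w. 0 < fst w} (\<lambda>w. \<epsilon> * exp (Re (P (to_complex w))) *
        cos (max (- (pi / 2)) (min (pi / 2) (Im (P (to_complex w))))))"
      by (intro continuous_intros Pc_cont)
    then show ?thesis
      by (subst continuous_on_cong[OF refl]) (auto simp: Q_def)
  qed
  have open_pos: "open {w::real \<times> real. 0 < fst w}" by (intro open_Collect_less continuous_intros)
  have Q_meas: "Q \<in> borel_measurable borel"
  proof -
    have "(\<lambda>w. if w \<in> {w. 0 < fst w} then Q w else 0) \<in> borel_measurable borel"
      using open_pos Q_cont_pos by (intro borel_measurable_continuous_on_if) auto
    moreover have "(\<lambda>w. if w \<in> {w. 0 < fst w} then Q w else 0) = Q" by (auto simp: Q_def)
    ultimately show ?thesis by simp
  qed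
  have V1_Q: "V1 (to_complex w) = (if fst w < t + 2 * L then Q w else 0)" for w
    by (simp add: V1_def Q_def)
  have V2_cont: "continuous_on S (\<lambda>w. V2 (to_complex w))" for S
    using L unfolding V2_def by (intro continuous_intros) auto
  have V2_meas: "(\<lambda>w. V2 (to_complex w)) \<in> borel_measurable borel"
    using V2_cont by (rule borel_measurable_continuous_onI)
  have V_meas: "V \<in> borel_measurable borel"
    unfolding V_def[abs_def] V1_Q
  proof (intro measurable_If borel_measurable_max Q_meas V2_meas borel_measurable_const)
    show "{w \<in> space borel. \<bar>snd w :: real\<bar> < L} \<in> sets (borel :: (real \<times> real) measure)"
      by (simp, intro borel_open open_Collect_less continuous_intros)
    show "{w \<in> space borel. fst w < t + 2 * L} \<in> sets (borel :: (real \<times> real) measure)"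
      by (simp, intro borel_open open_Collect_less continuous_intros)
  qed
  have Q_cont: "continuous_on (closure D) Q"
  proof (clarsimp simp only: continuous_on_eq_continuous_within)
    fix w assume w: "w \<in> closure D"
    show "continuous (at w within closure D) Q"
    proof (cases "0 < fst w")
      case True
      then have "isCont Q w"
        using Q_cont_pos open_pos continuous_on_eq_continuous_at by blast
      then show ?thesis by (rule continuous_at_imp_continuous_at_within)
    next
      case False
      then have "fst w = 0" using clD[OF w] by simp
      then have w0: "w = 0" using clD[OF w] by (simp add: prod_eq_iff)
      \<comment> \<open>The apex is the only point of the closure with abscissa 0. There the bound
        \<open>exp (- a / norm v powr \<beta>)\<close>, up to bounded factors, forces the limit
        0.\<close>
      define a where "a = c * cos (\<beta> * (pi / 2)) * 3 * A\<^sup>2"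
      have "\<beta> * (pi / 2) < 1 * (pi / 2)" using \<beta> by (intro mult_strict_right_mono) auto
      then have "0 < cos (\<beta> * (pi / 2))" using \<beta> by (intro cos_gt_zero) auto
      then have a: "0 < a" unfolding a_def using c(1) A by (intro mult_pos_pos) auto
      have Q_le: "\<bar>Q v\<bar> \<le> \<epsilon> * exp (c * norm v powr \<beta> - a / norm v powr \<beta>)" for v
      proof (cases "0 < fst v")
        case True
        then have "Re (P (to_complex v)) \<le> c * norm v powr \<beta> - a / norm v powr \<beta>"
          using Re_horn_map_le[of "to_complex v" \<beta> A] \<beta> A by (simp add: P_def c(2) a_def)
        then have "\<epsilon> * exp (Re (P (to_complex v))) * \<bar>cos (max (- (pi / 2)) (min (pi / 2) (Im (P (to_complex v)))))\<bar>
            \<le> \<epsilon> * exp (c * norm v powr \<beta> - a / norm v powr \<beta>) * 1"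
          by (intro mult_mono) (auto simp: \<epsilon>_def)
        then show ?thesis using True by (simp add: Q_def abs_mult \<epsilon>_def)
      qed (simp add: Q_def \<epsilon>_def)
      have lim: "((\<lambda>r. \<epsilon> * exp (c * r powr \<beta> - a / r powr \<beta>)) \<longlongrightarrow> 0) (at_right 0)"
        using a c(1) \<beta>(1) by real_asymp
      have "filterlim norm (at_right 0) (at (0 :: real \<times> real))"
        unfolding filterlim_at by (auto simp: eventually_at intro!: tendsto_eq_intros exI[of _ 1])
      from filterlim_compose[OF lim this]
      have "((\<lambda>v :: real \<times> real. \<epsilon> * exp (c * norm v powr \<beta> - a / norm v powr \<beta>)) \<longlongrightarrow> 0) (at 0)" .
      then have "(Q \<longlongrightarrow> 0) (at 0)"
        by (rule Lim_null_comparison[rotated]) (use Q_le in auto)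
      moreover have "Q 0 = 0" by (simp add: Q_def)
      ultimately show ?thesis
        unfolding w0 continuous_within by (metis tendsto_within_subset subset_UNIV)
    qed
  qed
  have V_cont: "continuous_on (closure D) V"
  proof -
    \<comment> \<open>Gluing: near each point of the closure \<open>V\<close> agrees with one of
      three continuous functions. The middle one, \<open>max 0 V2\<close>, bridges the line where
      \<open>V1\<close> jumps.\<close>
    have V_cont_at: "continuous (at w within closure D) V"
      if "open S" "w \<in> S" "w \<in> closure D" and eq: "\<And>v. v \<in> S \<Longrightarrow> V v = f v" and f: "continuous_on (closure D) f"
      for S f w
    proof -
      have "continuous_on (closure D \<inter> S) f" using f by (rule continuous_on_subset) auto
      then have "continuous_on (closure D \<inter> S) V"
        by (subst continuous_on_cong[OF refl, of _ _ f]) (auto simp: eq)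
      then have "continuous (at w within closure D \<inter> S) V"
        using that by (simp add: continuous_on_eq_continuous_within)
      moreover have "at w within closure D \<inter> S = at w within closure D"
        using that by (intro at_within_nhd[of _ S]) auto
      ultimately show ?thesis by simp
    qed
    show ?thesis
    proof (clarsimp simp only: continuous_on_eq_continuous_within)
      fix w assume w: "w \<in> closure D"
      show "continuous (at w within closure D) V"
      proof (cases "fst w \<le> t + 4 * L")
        case True
        then have y: "\<bar>snd w\<bar> < L" using width clD[OF w] by fastforce
        show ?thesis
        proof (cases "fst w < t + 2 * L")
          case True
          show ?thesis
          proof (rule V_cont_at[of "{v. \<bar>snd v\<bar> < L} \<inter> {v. fst v < t + 2 * L}" _ "\<lambda>v. max (Q v) (V2 (to_complex v))"])
            show "continuous_on (closure D) (\<lambda>v. max (Q v) (V2 (to_complex v)))"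
              by (intro continuous_intros Q_cont V2_cont)
            show "open ({v::real\<times>real. \<bar>snd v\<bar> < L} \<inter> {v. fst v < t + 2 * L})"
              by (intro open_Int open_Collect_less continuous_intros)
          qed (use True y w in \<open>auto simp: V_def V1_Q\<close>)
        next
          case False
          show ?thesis
          proof (rule V_cont_at[of "{v. \<bar>snd v\<bar> < L} \<inter> {v. t + L < fst v}" _ "\<lambda>v. max 0 (V2 (to_complex v))"])
            show "continuous_on (closure D) (\<lambda>v. max 0 (V2 (to_complex v)))"
              by (intro continuous_intros V2_cont)
            show "open ({v::real\<times>real. \<bar>snd v\<bar> < L} \<inter> {v. t + L < fst v})"
              by (intro open_Int open_Collect_less continuous_intros)
            show "w \<in> {v. \<bar>snd v\<bar> < L} \<inter> {v. t + L < fst v}" using False y L by auto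
            show "V v = max 0 (V2 (to_complex v))" if v: "v \<in> {v. \<bar>snd v\<bar> < L} \<inter> {v. t + L < fst v}" for v
            proof (cases "fst v \<le> t + 3 * L")
              case True
              then have "2 \<le> V2 (to_complex v)" using v by (intro V2_ge_2) auto
              then show ?thesis using V1_le_1[of v] v by (simp add: V_def max_def)
            next
              case False
              then have "V1 (to_complex v) = 0" using L by (simp add: V1_def)
              then show ?thesis using v by (simp add: V_def)
            qed
          qed (rule w)
        qed
      next
        case False
        show ?thesis
        proof (rule V_cont_at[of "{v. t + 4 * L < fst v}" _ "\<lambda>v. 0"])
          show "open {v::real\<times>real. t + 4 * L < fst v}"
            by (intro open_Collect_less continuous_intros)
          show "V v = 0" if "v \<in> {v. t + 4 * L < fst v}" for v
            using V_nz(3)[of v] that by force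
        qed (use False w in auto)
      qed
    qed
  qed
  have sub: "submean_on K V" if K: "compact K" "K \<subseteq> D" for K
  proof -
    let ?SM = "\<lambda>C w. \<exists>a b. \<forall>v. V w + Re (a * to_complex v + b * (to_complex v)\<^sup>2) - C * norm v ^ 3 \<le> V (w + v)"
    have SM_mono: "?SM C' w" if "?SM C w" "C \<le> C'" for C C' w
    proof -
      obtain a b where ab: "\<And>v. V w + Re (a * to_complex v + b * (to_complex v)\<^sup>2) - C * norm v ^ 3 \<le> V (w + v)"
        using \<open>?SM C w\<close> by blast
      have "V w + Re (a * to_complex v + b * (to_complex v)\<^sup>2) - C' * norm v ^ 3 \<le> V (w + v)" for v
        using ab[of v] mult_right_mono[OF \<open>C \<le> C'\<close>, of "norm v ^ 3"] by simp
      then show ?thesis by blast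
    qed
    define F1 where "F1 z = of_real \<epsilon> * exp (P z)" for z
    have Re_F1: "Re (F1 z) = \<epsilon> * exp (Re (P z)) * cos (Im (P z))" for z
      by (simp add: F1_def Re_exp)
    \<comment> \<open>A neighbourhood of the contact set on which \<open>Re F1\<close> stays below
      \<open>V\<close>: for phases between \<open>pi / 2\<close> and \<open>3 * pi / 2\<close> the
      cosine is nonpositive, and beyond \<open>t + 2 * L\<close> the barrier dominates.\<close>
    define U1 where "U1 = ({z. 0 < Re z} \<inter> P -` {u. \<bar>Im u\<bar> < 3 * pi / 2}) \<inter> {z. Re z < t + 3 * L}"
    have "open U1"
      unfolding U1_def
      by (intro open_Int open_halfspace_Re_lt continuous_open_preimage P_cont open_halfspace_Re_gt
          open_Collect_less continuous_intros)
    have F1_hol: "F1 holomorphic_on U1"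
      unfolding F1_def[abs_def] P_def
      by (intro holomorphic_intros holomorphic_on_subset[OF horn_map_holomorphic]) (auto simp: U1_def)
    \<comment> \<open>The weak inequalities make the set compact, while their bounds lie strictly
      inside those of \<open>U1\<close>.\<close>
    define K1 where "K1 = K \<inter> (\<lambda>w. P (to_complex w)) -` {u. \<bar>Im u\<bar> \<le> pi / 2} \<inter> {w. fst w \<le> t + 2 * L}"
    have K_pos: "0 < fst w" if "w \<in> K" for w using K that by (auto simp: in_D_iff)
    have "compact K1"
    proof -
      have "closed (K \<inter> (\<lambda>w. P (to_complex w)) -` {u. \<bar>Im u\<bar> \<le> pi / 2})"
        using K K_pos
        by (intro continuous_closed_preimage continuous_on_subset[OF Pc_cont] compact_imp_closed
            closed_Collect_le continuous_intros) auto
      then have "closed K1"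
        unfolding K1_def by (rule closed_Int) (intro closed_Collect_le continuous_intros)
      moreover have "K1 = K \<inter> K1" by (auto simp: K1_def)
      ultimately show ?thesis using K(1) compact_Int_closed by metis
    qed
    have "to_complex ` K1 \<subseteq> U1"
    proof
      fix z assume "z \<in> to_complex ` K1"
      then obtain w where w: "w \<in> K1" "z = to_complex w" by auto
      have "\<bar>Im (P z)\<bar> \<le> pi / 2" using w by (auto simp: K1_def)
      then have "\<bar>Im (P z)\<bar> < 3 * pi / 2" using pi_gt_zero by linarith
      then show "z \<in> U1" using w K_pos[of w] L by (auto simp: K1_def U1_def)
    qed
    have ge1: "Re (F1 (to_complex w)) \<le> V w" if w: "to_complex w \<in> U1" for w
    proof (cases "\<bar>Im (P (to_complex w))\<bar> < pi / 2")
      case False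
      have "cos \<bar>Im (P (to_complex w))\<bar> \<le> 0"
      proof -
        have "0 \<le> cos (pi - \<bar>Im (P (to_complex w))\<bar>)"
          using False w by (intro cos_ge_zero) (auto simp: U1_def)
        then show ?thesis by (simp add: cos_diff)
      qed
      then have "Re (F1 (to_complex w)) \<le> 0"
        by (simp add: Re_F1 \<epsilon>_def mult_nonneg_nonpos)
      then show ?thesis using V_nonneg[of w] by linarith
    next
      case True
      have x: "0 < fst w" "fst w < t + 3 * L" using w by (auto simp: U1_def)
      have wD: "w \<in> D" using x True by (intro horn)
      have y: "\<bar>snd w\<bar> < L" using wD width[of "fst w"] x L by (auto simp: in_D_iff)
      show ?thesis
      proof (cases "fst w < t + 2 * L")
        case True': True
        then have "V1 (to_complex w) = Re (F1 (to_complex w))"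
          using x cos_clamp_eq[OF True] by (simp add: V1_def Re_F1)
        then show ?thesis using y by (simp add: V_def)
      next
        case False
        then have "2 \<le> V2 (to_complex w)" using x L by (intro V2_ge_2) auto
        moreover have "Re (F1 (to_complex w)) \<le> 1 * 1"
          unfolding Re_F1 using exp_le_1[OF wD x(2)] cos_clamp_nonneg[of "Im (P (to_complex w))"] cos_clamp_eq[OF True]
          by (intro mult_mono) auto
        ultimately show ?thesis using y by (simp add: V_def le_max_iff_disj)
      qed
    qed
    obtain C1 where C1: "C1 \<ge> 0" "\<And>w. w \<in> K1 \<Longrightarrow> V w = Re (F1 (to_complex w)) \<Longrightarrow> ?SM C1 w"
      using submean_at_holomorphic[of U1 F1 K1 V 4, OF \<open>open U1\<close> F1_hol \<open>compact K1\<close> \<open>to_complex ` K1 \<subseteq> U1\<close> bdd ge1]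
      by blast
    define F2 where "F2 z = (- (z - of_real t)\<^sup>2 + of_real (4 * L) * (z - of_real t) - of_real (L\<^sup>2)) / of_real (L\<^sup>2)" for z :: complex
    define U2 where "U2 = {z. \<bar>Im z\<bar> < L}"
    have "open U2" unfolding U2_def by (intro open_Collect_less continuous_intros)
    have F2_hol: "F2 holomorphic_on U2"
      unfolding F2_def[abs_def] using L by (intro holomorphic_intros) auto
    have V2_F2: "V2 z = Re (F2 z)" for z by (simp add: V2_def F2_def)
    define K2 where "K2 = K \<inter> {w. fst w \<le> t + 4 * L}"
    have "compact K2"
      unfolding K2_def using K by (intro compact_Int_closed closed_Collect_le continuous_intros)
    have "to_complex ` K2 \<subseteq> U2"
    proof
      fix z assume "z \<in> to_complex ` K2"
      then obtain w where w: "w \<in> K2" "z = to_complex w" by auto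
      then have "w \<in> D" "fst w \<le> t + 4 * L" using K by (auto simp: K2_def)
      then have "\<bar>snd w\<bar> < L" using width[of "fst w"] by (auto simp: in_D_iff)
      then show "z \<in> U2" using w by (simp add: U2_def)
    qed
    have ge2: "Re (F2 (to_complex w)) \<le> V w" if "to_complex w \<in> U2" for w
      using that by (simp add: V_def U2_def V2_F2)
    obtain C2 where C2: "C2 \<ge> 0" "\<And>w. w \<in> K2 \<Longrightarrow> V w = Re (F2 (to_complex w)) \<Longrightarrow> ?SM C2 w"
      using submean_at_holomorphic[of U2 F2 K2 V 4, OF \<open>open U2\<close> F2_hol \<open>compact K2\<close> \<open>to_complex ` K2 \<subseteq> U2\<close> bdd ge2]
      by blast
    have "?SM (C1 + C2) w" if w: "w \<in> K" for w
    proof (cases "V w = 0")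
      \<comment> \<open>At a zero of the nonnegative \<open>V\<close> the constant 0 is already a
        minorant, so \<open>a = b = 0\<close> works.\<close>
      case True
      have "V w + Re (0 * to_complex v + 0 * (to_complex v)\<^sup>2) - (C1 + C2) * norm v ^ 3 \<le> V (w + v)" for v
      proof -
        have "- ((C1 + C2) * norm v ^ 3) \<le> 0" using C1(1) C2(1) by simp
        also have "0 \<le> V (w + v)" by (rule V_nonneg)
        finally show ?thesis using True by simp
      qed
      then show ?thesis by blast
    next
      case False
      note nz = V_nz[OF False]
      then have "V w = V1 (to_complex w) \<or> V w = V2 (to_complex w)"
        by (simp add: V_def max_def)
      then consider "V w = V1 (to_complex w)" | "V w = V2 (to_complex w)" by blast
      then show ?thesis
      proof cases
        case 1
        then have nz1: "V1 (to_complex w) \<noteq> 0" using False by simp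
        note nz1 = V1_nz[OF nz1]
        have "V w = Re (F1 (to_complex w))"
          using 1 nz1 cos_clamp_eq[OF nz1(3)] by (simp add: V1_def Re_F1)
        moreover have "w \<in> K1" using w nz1 by (auto simp: K1_def)
        ultimately have "?SM C1 w" by (intro C1(2))
        then show ?thesis by (rule SM_mono) (use C2(1) in simp)
      next
        case 2
        then have "V w = Re (F2 (to_complex w))" by (simp add: V2_F2)
        moreover have "w \<in> K2" using w nz by (auto simp: K2_def)
        ultimately have "?SM C2 w" by (intro C2(2))
        then show ?thesis by (rule SM_mono) (use C1(1) in simp)
      qed
    qed
    then show ?thesis unfolding submean_on_def using C1(1) C2(1) by (intro exI[of _ "C1 + C2"]) auto
  qed
  define E where "E = {\<omega> \<in> space M. exit_time B D \<omega> < \<infinity> \<and> norm (exit_position B D \<omega>) > t}"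
  have [measurable]: "exit_time B D \<in> borel_measurable M" "exit_position B D \<in> borel_measurable M"
    using open_D by (auto intro: measurable_exit_time_open measurable_exit_position)
  have E_sets[measurable]: "E \<in> sets M" unfolding E_def by measurable
  have start_in: "(1, 0) \<in> D" using A by (simp add: in_D_iff)
  \<comment> \<open>The set of increments, not positions: the support of \<open>V\<close> shifted by
    the start \<open>(1, 0)\<close>, slightly enlarged.\<close>
  define S where "S = cbox (- 1, - L) (t + 4 * L, L)"
  have S: "S \<in> sets borel" "emeasure lborel S < \<infinity>" by (auto simp: S_def emeasure_lborel_cbox_eq)
  \<comment> \<open>A nonzero \<open>V\<close>, at most 4, at the stopped position means either an
    exit beyond \<open>t\<close> or a path still inside \<open>D\<close> at time \<open>n\<close> in
    the bounded support of \<open>V\<close>. The latter has probability of order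
    \<open>1 / n\<close>.\<close>
  have main: "V (1, 0) \<le> 4 * measure M E + 4 * measure lborel S / real n" if "n > 0" for n :: nat
  proof -
    let ?S = "\<lambda>\<omega>. B (stopped_time B D (real n) \<omega>) \<omega>"
    have n: "0 < real n" using that by simp
    define G where "G = {\<omega> \<in> space M. B (real n) \<omega> - B 0 \<omega> \<in> S}"
    have [measurable]: "?S \<in> borel_measurable M" "B (real n) \<in> borel_measurable M" "B 0 \<in> borel_measurable M"
      using open_D n by (auto intro: measurable_stopped_value random_variable_B)
    have G_sets[measurable]: "G \<in> sets M" unfolding G_def using S(1) by measurable
    have "V (1, 0) \<le> expectation (\<lambda>\<omega>. V (?S \<omega>))"
      by (rule optional_stopping[OF open_D start_in n V_meas bdd V_cont sub])
    also have "\<dots> \<le> expectation (\<lambda>\<omega>. 4 * indicator E \<omega> + 4 * indicator G \<omega>)"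
    proof (rule integral_mono_AE)
      show "integrable M (\<lambda>\<omega>. V (?S \<omega>))"
        using bdd V_meas by (intro integrable_const_bound[where B = 4]) auto
      show "integrable M (\<lambda>\<omega>. 4 * indicator E \<omega> + 4 * indicator G \<omega> :: real)"
        by (intro Bochner_Integration.integrable_add integrable_mult_right integrable_real_indicator) (auto simp: emeasure_eq_measure)
      show "AE \<omega> in M. V (?S \<omega>) \<le> 4 * indicator E \<omega> + 4 * indicator G \<omega>"
        using start AE_space
      proof eventually_elim
        fix \<omega> assume \<omega>: "B 0 \<omega> = (1, 0)" "\<omega> \<in> space M"
        note path = continuous_paths[OF \<omega>(2)]
        show "V (?S \<omega>) \<le> 4 * indicator E \<omega> + 4 * indicator G \<omega>"
        proof (cases "V (?S \<omega>) = 0")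
          case False
          show ?thesis
          proof (cases "exit_time B D \<omega> \<le> ereal (real n)")
            case True
            define \<tau> where "\<tau> = stopped_time B D (real n) \<omega>"
            have \<tau>: "exit_time B D \<omega> = ereal \<tau>"
              using ereal_stopped_time[of "real n" B D \<omega>] True by (simp add: \<tau>_def min_def)
            have "B \<tau> \<omega> \<notin> D" by (rule notin_at_exit_time[of D B \<omega>, OF open_D path \<tau>])
            then have "t < fst (B \<tau> \<omega>)" using V_outside False by (simp add: \<tau>_def)
            then have "t < norm (B \<tau> \<omega>)" using norm_fst_le[of "fst (B \<tau> \<omega>)" "snd (B \<tau> \<omega>)"] by simp
            then have "\<omega> \<in> E" using \<omega> \<tau> by (simp add: E_def exit_position_def)
            then show ?thesis using V_le[of "?S \<omega>"] by (simp add: indicator_def)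
          next
            case False': False
            then have "stopped_time B D (real n) \<omega> = real n"
              by (simp add: stopped_time_def min_def)
            then have "V (B (real n) \<omega>) \<noteq> 0" using False by simp
            from V_nz[OF this] have "\<omega> \<in> G"
              using \<omega> L by (cases "B (real n) \<omega>") (auto simp: G_def S_def cbox_Pair_eq)
            then show ?thesis using V_le[of "?S \<omega>"] by (simp add: indicator_def)
          qed
        qed simp
      qed
    qed
    also have "\<dots> = 4 * measure M E + 4 * measure M G"
      by (subst Bochner_Integration.integral_add) (auto intro!: integrable_mult_right integrable_real_indicator simp: emeasure_eq_measure)
    also have "measure M G \<le> measure lborel S / real n"
      unfolding G_def using n S by (rule prob_bounded_increment)
    finally show ?thesis by simp
  qed
  have "V (1, 0) \<le> 4 * measure M E"
  proof (rule LIMSEQ_le_const)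
    show "(\<lambda>n. 4 * measure M E + 4 * measure lborel S / real n) \<longlonglongrightarrow> 4 * measure M E"
      by real_asymp
    show "\<exists>N. \<forall>n\<ge>N. V (1, 0) \<le> 4 * measure M E + 4 * measure lborel S / real n"
      using main by (intro exI[of _ 1]) auto
  qed
  moreover have "\<epsilon> * exp (c * (1 - 3 * A\<^sup>2)) \<le> V (1, 0)"
  proof -
    have one: "to_complex (1, 0) = 1" by (simp add: complex_eq_iff)
    have "P 1 = of_real (c * (1 - 3 * A\<^sup>2))" by (simp add: P_def horn_map_def c(2))
    then have "V1 1 = \<epsilon> * exp (c * (1 - 3 * A\<^sup>2))"
      using t L by (simp add: V1_def)
    then show ?thesis using L by (simp add: V_def one)
  qed
  \<comment> \<open>Placing the barrier at \<open>t + 4 * L\<close> instead of \<open>t\<close>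
    costs a bounded factor: the tangent bound increases the power by at most
    \<open>8 * A * \<beta>\<close>, and \<open>c\<close> times this is
    \<open>4 * pi\<close>.\<close>
  moreover have "exp (- c * t powr \<beta>) * exp (- 4 * pi) \<le> \<epsilon>"
  proof -
    have "(t + 4 * L) powr \<beta> \<le> t powr \<beta> + \<beta> * t powr (\<beta> - 1) * (4 * L)"
      using t L \<beta> by (intro powr_add_le_tangent) auto
    also have "\<beta> * t powr (\<beta> - 1) * (4 * L) = 8 * A * \<beta> * (t powr (\<beta> - 1) * t powr \<alpha>)"
      by (simp add: L_def)
    also have "t powr (\<beta> - 1) * t powr \<alpha> = 1"
      using t by (simp add: \<beta>_def powr_add[symmetric])
    finally have "c * (t + 4 * L) powr \<beta> \<le> c * (t powr \<beta> + 8 * A * \<beta>)"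
      using c(1) by (intro mult_left_mono) auto
    also have "\<dots> = c * t powr \<beta> + 4 * pi"
      using A \<beta> by (simp add: c(2) distrib_left)
    finally show ?thesis by (simp add: \<epsilon>_def exp_add[symmetric])
  qed
  then have "exp (- c * t powr \<beta>) * exp (- 4 * pi) * exp (c * (1 - 3 * A\<^sup>2)) \<le> \<epsilon> * exp (c * (1 - 3 * A\<^sup>2))"
    by (intro mult_right_mono) auto
  moreover have "exp (- c * t powr \<beta>) * exp (- 4 * pi) * exp (c * (1 - 3 * A\<^sup>2))
    = exp (c * (1 - 3 * A\<^sup>2) - 4 * pi) * exp (- c * t powr \<beta>)"
    unfolding exp_add[symmetric] by (simp add: algebra_simps)
  ultimately have "exp (c * (1 - 3 * A\<^sup>2) - 4 * pi) * exp (- c * t powr \<beta>) \<le> 4 * measure M E"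
    by linarith
  then show ?thesis by (simp add: E_def \<beta>_def)
qed

section \<open>The upper bound with arbitrarily small loss\<close>

text \<open>The explicit bound is used with \<open>T = (1 - \<epsilon>) * t\<close>, which leaves
  \<open>\<epsilon> * t\<close> for the sublinear width. The threshold for \<open>t\<close> is
  uniform over all Brownian motions, as the final supremum requires.\<close>

lemma exit_tail_upper_eventually:
  fixes \<alpha> A \<delta> :: real
  assumes \<alpha>: "0 < \<alpha>" "\<alpha> < 1" and A: "0 < A" and \<delta>: "0 < \<delta>"
  defines "c \<equiv> pi / (2 * A * (1 - \<alpha>))"
  shows "\<forall>\<^sub>F t in at_top. \<forall>(M :: 'w measure) B. planar_brownian_motion M B (1, 0) \<longrightarrow>
    measure M {\<omega> \<in> space M. exit_time B (parabola_domain A \<alpha>) \<omega> < \<infinity> \<and>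
      norm (exit_position B (parabola_domain A \<alpha>) \<omega>) > t}
    \<le> exp ((\<delta> - c) * t powr (1 - \<alpha>))"
proof -
  define \<beta> where "\<beta> = 1 - \<alpha>"
  have \<beta>: "0 < \<beta>" "\<beta> < 1" using \<alpha> by (auto simp: \<beta>_def)
  have c: "0 < c" using \<alpha> A by (simp add: c_def)
  \<comment> \<open>The factor \<open>1 - \<epsilon>\<close> is lost twice, in the rate and in
    \<open>T\<close>; the choice keeps this loss within \<open>\<delta> / 2\<close>, and the other
    half absorbs the constant \<open>H\<close>.\<close>
  define \<epsilon> where "\<epsilon> = min (1 / 2) (\<delta> / (4 * c))"
  have \<epsilon>: "0 < \<epsilon>" "\<epsilon> < 1" "2 * c * \<epsilon> \<le> \<delta> / 2"
    using c \<delta> by (auto simp: \<epsilon>_def min_def field_simps)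
  define \<kappa> where "\<kappa> = c * (1 - \<epsilon>)"
  define H where "H = exp (\<kappa> * (2 powr \<beta> + \<beta> * A)) / cos ((1 - \<epsilon>) * (pi / 2))"
  have "\<forall>\<^sub>F t in at_top. 1 < (1 - \<epsilon>) * t \<and> (1 - \<epsilon>) * t + A * ((1 - \<epsilon>) * t) powr \<alpha> \<le> t \<and>
      H \<le> exp (\<delta> / 2 * t powr \<beta>) \<and> 0 < t"
  proof (intro eventually_conj)
    have \<epsilon>': "0 < 1 - \<epsilon>" using \<epsilon> by simp
    show "\<forall>\<^sub>F t in at_top. 1 < (1 - \<epsilon>) * t"
      using \<epsilon>' by real_asymp
    have "\<forall>\<^sub>F t in at_top. A * ((1 - \<epsilon>) * t) powr \<alpha> \<le> \<epsilon> * t"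
      using \<epsilon>' \<epsilon> \<alpha> A by real_asymp
    then show "\<forall>\<^sub>F t in at_top. (1 - \<epsilon>) * t + A * ((1 - \<epsilon>) * t) powr \<alpha> \<le> t"
      by eventually_elim (simp add: algebra_simps)
    have "filterlim (\<lambda>t. exp (\<delta> / 2 * t powr \<beta>)) at_top at_top"
      using \<delta> \<beta> by real_asymp
    then show "\<forall>\<^sub>F t in at_top. H \<le> exp (\<delta> / 2 * t powr \<beta>)"
      by (simp add: filterlim_at_top)
    show "\<forall>\<^sub>F t in at_top. (0::real) < t" by (rule eventually_gt_at_top)
  qed
  then show ?thesis
  proof eventually_elim
    case (elim t)
    show ?case
    proof (intro allI impI)
      fix M :: "'w measure" and B assume BM: "planar_brownian_motion M B (1, 0)"
      let ?p = "measure M {\<omega> \<in> space M. exit_time B (parabola_domain A \<alpha>) \<omega> < \<infinity> \<and>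
        norm (exit_position B (parabola_domain A \<alpha>) \<omega>) > t}"
      have "?p \<le> H * exp (- \<kappa> * ((1 - \<epsilon>) * t) powr \<beta>)"
        using exit_tail_upper_explicit[OF \<alpha> A \<epsilon>(1,2), of "(1 - \<epsilon>) * t" t M B] elim BM
        by (simp add: H_def \<kappa>_def \<beta>_def c_def)
      also have "\<dots> \<le> exp (\<delta> / 2 * t powr \<beta>) * exp (- \<kappa> * ((1 - \<epsilon>) * t) powr \<beta>)"
        using elim by (intro mult_right_mono) auto
      also have "\<dots> = exp (\<delta> / 2 * t powr \<beta> - \<kappa> * ((1 - \<epsilon>) * t) powr \<beta>)"
        by (simp add: exp_add[symmetric])
      also have "\<dots> \<le> exp ((\<delta> - c) * t powr \<beta>)"
      proof -
        have "(1 - \<epsilon>) powr 1 \<le> (1 - \<epsilon>) powr \<beta>"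
          using \<epsilon> \<beta> by (intro powr_mono') auto
        then have "(1 - \<epsilon>) * t powr \<beta> \<le> (1 - \<epsilon>) powr \<beta> * t powr \<beta>"
          using \<epsilon> by (intro mult_right_mono) auto
        also have "\<dots> = ((1 - \<epsilon>) * t) powr \<beta>"
          using \<epsilon> elim by (simp add: powr_mult)
        finally have "\<kappa> * ((1 - \<epsilon>) * t powr \<beta>) \<le> \<kappa> * ((1 - \<epsilon>) * t) powr \<beta>"
          using c \<epsilon> by (intro mult_left_mono) (auto simp: \<kappa>_def)
        moreover have "(c - \<delta> / 2) * t powr \<beta> \<le> \<kappa> * ((1 - \<epsilon>) * t powr \<beta>)"
        proof -
          have "c - \<delta> / 2 \<le> c - 2 * c * \<epsilon>" using \<epsilon>(3) by simp
          also have "\<dots> \<le> \<kappa> * (1 - \<epsilon>)"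
            using mult_nonneg_nonneg[of c "\<epsilon> * \<epsilon>"] c by (simp add: \<kappa>_def algebra_simps)
          finally have "(c - \<delta> / 2) * t powr \<beta> \<le> (\<kappa> * (1 - \<epsilon>)) * t powr \<beta>"
            by (intro mult_right_mono) auto
          then show ?thesis by (simp only: mult.assoc)
        qed
        ultimately show ?thesis by (simp add: algebra_simps)
      qed
      finally show "?p \<le> exp ((\<delta> - c) * t powr (1 - \<alpha>))" by (simp add: \<beta>_def)
    qed
  qed
qed

section \<open>The tail of the exit position\<close>

theorem proposition1:
  fixes \<alpha> A :: real
  assumes "0 < \<alpha>" and "\<alpha> < 1" and "0 < A"
  shows "\<exists>C\<^sub>1>0. \<exists>C\<^sub>2>0. \<exists>g \<in> o[at_top](\<lambda>t::real. t powr (1 - \<alpha>)).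
    \<forall>\<^sub>F t in at_top. \<forall>(M :: 'w measure) B.
      planar_brownian_motion M B (1, 0) \<longrightarrow>
      (let D = parabola_domain A \<alpha>;
           p = measure M {\<omega> \<in> space M. exit_time B D \<omega> < \<infinity> \<and> norm (exit_position B D \<omega>) > t}
       in C\<^sub>1 * exp (- (pi / (2 * A * (1 - \<alpha>))) * t powr (1 - \<alpha>)) \<le> p \<and>
          p \<le> C\<^sub>2 * exp (- (pi / (2 * A * (1 - \<alpha>))) * t powr (1 - \<alpha>) + g t))"
proof -
  define c where "c = pi / (2 * A * (1 - \<alpha>))"
  have c: "0 < c" using assms by (simp add: c_def)
  let ?p = "\<lambda>(M :: 'w measure) B t. measure M {\<omega> \<in> space M. exit_time B (parabola_domain A \<alpha>) \<omega> < \<infinity> \<and>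
    norm (exit_position B (parabola_domain A \<alpha>) \<omega>) > t}"
  \<comment> \<open>The error term must be one function of \<open>t\<close> for all motions, so it
    is the supremum of the excess of the log-probability over the claimed exponent. Null
    probabilities are left out because their logarithm is meaningless; the inserted 0 makes the set
    nonempty and the supremum nonnegative.\<close>
  define X where "X t = insert 0 {ln (?p M B t) + c * t powr (1 - \<alpha>) | (M :: 'w measure) B.
    planar_brownian_motion M B (1, 0) \<and> 0 < ?p M B t}" for t
  define g where "g t = Sup (X t)" for t
  have X_upper: "x \<le> b" if "x \<in> X t" "0 \<le> b"
      "\<And>(M :: 'w measure) B. planar_brownian_motion M B (1, 0) \<Longrightarrow> ?p M B t \<le> exp (b - c * t powr (1 - \<alpha>))" for x b t
  proof -
    have "ln q + c * t powr (1 - \<alpha>) \<le> b" if "0 < q" "q \<le> exp (b - c * t powr (1 - \<alpha>))" for q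
      using ln_le_cancel_iff[of q "exp (b - c * t powr (1 - \<alpha>))"] that by simp
    then show ?thesis using that unfolding X_def by blast
  qed
  \<comment> \<open>A real \<open>Sup\<close> means something only for bounded sets; that
    probabilities are at most 1 suffices here.\<close>
  have X_bdd: "bdd_above (X t)" for t
  proof (rule bdd_aboveI)
    show "x \<le> c * t powr (1 - \<alpha>)" if "x \<in> X t" for x
    proof (rule X_upper[OF that])
      fix M :: "'w measure" and B assume "planar_brownian_motion M B (1, 0)"
      then interpret planar_brownian_motion M B "(1, 0)" .
      show "?p M B t \<le> exp (c * t powr (1 - \<alpha>) - c * t powr (1 - \<alpha>))" by simp
    qed (use c in simp)
  qed
  have X_ne: "X t \<noteq> {}" for t by (simp add: X_def)
  have g_nonneg: "0 \<le> g t" for t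
    unfolding g_def by (rule cSup_upper[OF _ X_bdd]) (simp add: X_def)
  have g_small: "g \<in> o[at_top](\<lambda>t. t powr (1 - \<alpha>))"
  proof (rule landau_o.smallI)
    fix \<delta> :: real assume \<delta>: "0 < \<delta>"
    show "\<forall>\<^sub>F t in at_top. norm (g t) \<le> \<delta> * norm (t powr (1 - \<alpha>))"
      using exit_tail_upper_eventually[where 'w = 'w, OF assms \<delta>]
    proof eventually_elim
      case (elim t)
      have "g t \<le> \<delta> * t powr (1 - \<alpha>)"
        unfolding g_def
      proof (rule cSup_least[OF X_ne])
        show "x \<le> \<delta> * t powr (1 - \<alpha>)" if "x \<in> X t" for x
          using elim \<delta> by (intro X_upper[OF that]) (auto simp: c_def left_diff_distrib)
      qed
      then show ?case using g_nonneg[of t] by simp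
    qed
  qed
  have upper: "?p M B t \<le> 1 * exp (- c * t powr (1 - \<alpha>) + g t)"
    if "planar_brownian_motion M B (1, 0)" for M :: "'w measure" and B t
  proof (cases "0 < ?p M B t")
    case True
    have "ln (?p M B t) + c * t powr (1 - \<alpha>) \<le> g t"
      unfolding g_def by (rule cSup_upper[OF _ X_bdd]) (use that True in \<open>auto simp: X_def\<close>)
    then have "ln (?p M B t) \<le> - c * t powr (1 - \<alpha>) + g t" by (simp only: minus_mult_left[symmetric])
    then have "exp (ln (?p M B t)) \<le> exp (- c * t powr (1 - \<alpha>) + g t)" by (simp only: exp_le_cancel_iff)
    then show ?thesis by (simp only: exp_ln[OF True] mult_1)
  next
    case False
    then show ?thesis by (simp add: order_trans[OF _ exp_ge_zero])
  qed
  define C1 where "C1 = exp (c * (1 - 3 * A\<^sup>2) - 4 * pi) / 4"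
  have "\<forall>\<^sub>F t::real in at_top. 1 < t \<and> 8 * A * t powr \<alpha> \<le> t"
    using assms by (intro eventually_conj eventually_gt_at_top) real_asymp
  then have "\<forall>\<^sub>F t in at_top. \<forall>(M :: 'w measure) B. planar_brownian_motion M B (1, 0) \<longrightarrow>
      C1 * exp (- c * t powr (1 - \<alpha>)) \<le> ?p M B t \<and> ?p M B t \<le> 1 * exp (- c * t powr (1 - \<alpha>) + g t)"
  proof eventually_elim
    case (elim t)
    then show ?case
      using exit_tail_lower_explicit[OF assms, of t] upper unfolding C1_def c_def by blast
  qed
  moreover have "0 < C1" by (simp add: C1_def)
  ultimately show ?thesis
    using g_small unfolding c_def Let_def by (intro exI[of _ C1] exI[of _ 1] bexI[of _ g] conjI) auto
qed

end
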